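(* Let $R$ be a commutative noetherian ring, let $A$ be a DG $R$-algebra such that each $A_i$ is a free $R$-module of finite rank, let $t\in R$, and let $B=K^R(t)\otimes_RA$. Assume that $R$ is $tR$-adically complete. Let $N$ be a semi-free DG $B$-module whose semi-basis over $B$ is finite in each degree. If $\operatorname{Ext}^2_B(N,N)=0$, then $N$ is liftable to $A$ with a semi-free lifting; that is, there is a semi-free DG $A$-module $M$ with $N\cong B\otimes_AM$ as DG $B$-modules.
   Context: Complexes are indexed homologically. A (commutative) DG $R$-algebra is an $R$-complex $A$ with $A_i=0$ for $i<0$ and an associative, unital chain map $A\otimes_RA\to A$ that is graded commutative ($ab=(-1)^{|a||b|}ba$, $a^2=0$ for $|a|$ odd). $K^R(t)$ is the Koszul complex $0\to R\xrightarrow{t}R\to0$ (concentrated in degrees $1,0$) with its DG algebra structure; $B=K^R(t)\otimes_RA$ is a DG $R$-algebra with product $(x\otimes a)(x'\otimes a')=(-1)^{|a||x'|}(xx')\otimes(aa')$, and the natural map $A\to B$ is a morphism of DG algebras. A DG $A$-module is an $R$-complex $M$ with an associative, unital chain map $A\otimes_RM\to M$; $B\otimes_AM$ is a DG $B$-module via $b(b'\otimes m)=(bb')\otimes m$. A DG module $F$ is semi-free if $F_i=0$ for $i\ll0$ and the underlying graded module $\oplus_iF_i$ has a basis (a semi-basis) over the underlying graded algebra. $\operatorname{Hom}_B(M,N)_p$ consists of degree-$p$ $R$-linear maps $f$ with $f(bm)=(-1)^{p|b|}bf(m)$, with the usual Hom differential; for $M$ semi-free, $\operatorname{Ext}^i_B(M,N)=\operatorname{H}_{-i}(\operatorname{Hom}_B(M,N))$.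 *)

theory Defs
  imports Main "HOL-Library.Product_Plus" "HOL-Library.Function_Algebras"
begin

definition ideal_of :: "'r::comm_ring_1 set \<Rightarrow> bool" where
  "ideal_of I \<longleftrightarrow> 0 \<in> I \<and> (\<forall>x\<in>I. \<forall>y\<in>I. x + y \<in> I) \<and> (\<forall>r. \<forall>x\<in>I. r * x \<in> I)"

definition noetherian :: "'r::comm_ring_1 itself \<Rightarrow> bool" where
  "noetherian _ \<longleftrightarrow> (\<forall>I :: 'r set. ideal_of I \<longrightarrow>
      (\<exists>F. finite F \<and> F \<subseteq> I \<and> I = {\<Sum>f\<in>F. c f * f | c. True}))"

text \<open>R is tR-adically complete: the canonical map R -> lim R/t^n R is bijective,
  i.e. every compatible sequence has exactly one limit.\<close>
definition adic_complete :: "'r::comm_ring_1 \<Rightarrow> bool" where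
  "adic_complete t \<longleftrightarrow> (\<forall>x :: nat \<Rightarrow> 'r. (\<forall>n. \<exists>r. x (Suc n) - x n = t ^ n * r) \<longrightarrow>
      (\<exists>!y. \<forall>n. \<exists>r. y - x n = t ^ n * r))"

definition rmod :: "('r::comm_ring_1 \<Rightarrow> 'm::ab_group_add \<Rightarrow> 'm) \<Rightarrow> 'm set \<Rightarrow> bool" where
  "rmod sm S \<longleftrightarrow> 0 \<in> S \<and> (\<forall>x\<in>S. \<forall>y\<in>S. x + y \<in> S) \<and> (\<forall>x\<in>S. - x \<in> S)
     \<and> (\<forall>r. \<forall>x\<in>S. sm r x \<in> S)
     \<and> (\<forall>r. \<forall>x\<in>S. \<forall>y\<in>S. sm r (x + y) = sm r x + sm r y)
     \<and> (\<forall>r s. \<forall>x\<in>S. sm (r + s) x = sm r x + sm s x)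
     \<and> (\<forall>r s. \<forall>x\<in>S. sm (r * s) x = sm r (sm s x))
     \<and> (\<forall>x\<in>S. sm 1 x = x)"

definition rlin :: "('r::comm_ring_1 \<Rightarrow> 'm::ab_group_add \<Rightarrow> 'm) \<Rightarrow> 'm set \<Rightarrow>
    ('r \<Rightarrow> 'n::ab_group_add \<Rightarrow> 'n) \<Rightarrow> 'n set \<Rightarrow> ('m \<Rightarrow> 'n) \<Rightarrow> bool" where
  "rlin sm S sn T f \<longleftrightarrow> (\<forall>x\<in>S. f x \<in> T) \<and> (\<forall>x\<in>S. \<forall>y\<in>S. f (x + y) = f x + f y)
     \<and> (\<forall>r. \<forall>x\<in>S. f (sm r x) = sn r (f x))"

definition free_fin_rank :: "('r::comm_ring_1 \<Rightarrow> 'm::ab_group_add \<Rightarrow> 'm) \<Rightarrow> 'm set \<Rightarrow> bool" where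
  "free_fin_rank sm S \<longleftrightarrow> (\<exists>(e :: nat \<Rightarrow> 'm) n. (\<forall>k<n. e k \<in> S) \<and>
      (\<forall>x\<in>S. \<exists>!c :: nat \<Rightarrow> 'r. (\<forall>k\<ge>n. c k = 0) \<and> x = (\<Sum>k<n. sm (c k) (e k))))"

definition sgnact :: "int \<Rightarrow> 'm::ab_group_add \<Rightarrow> 'm" where
  "sgnact k x = (if even k then x else - x)"

text \<open>A complex (homological indexing) is a family of R-modules carr i (all living in one
  ambient type), with scalar multiplication smul and differentials dif i : carr i -> carr (i-1).\<close>
record ('r, 'm) cx =
  carr :: "int \<Rightarrow> 'm set"
  smul :: "'r \<Rightarrow> 'm \<Rightarrow> 'm"
  dif  :: "int \<Rightarrow> 'm \<Rightarrow> 'm"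

text \<open>DG algebra: product mul i j : A_i x A_j -> A_(i+j), unit one.\<close>
record ('r, 'a) dga = "('r, 'a) cx" +
  mul :: "int \<Rightarrow> int \<Rightarrow> 'a \<Rightarrow> 'a \<Rightarrow> 'a"
  one :: 'a

text \<open>DG module: action act i j : A_i x M_j -> M_(i+j).\<close>
record ('r, 'a, 'm) dgm = "('r, 'm) cx" +
  act :: "int \<Rightarrow> int \<Rightarrow> 'a \<Rightarrow> 'm \<Rightarrow> 'm"

definition is_cx :: "('r::comm_ring_1, 'm::ab_group_add, 'z) cx_scheme \<Rightarrow> bool" where
  "is_cx C \<longleftrightarrow> (\<forall>i. rmod (smul C) (carr C i))
     \<and> (\<forall>i. rlin (smul C) (carr C i) (smul C) (carr C (i - 1)) (dif C i))
     \<and> (\<forall>i. \<forall>x\<in>carr C i. dif C (i - 1) (dif C i x) = 0)"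

definition is_dga :: "('r::comm_ring_1, 'a::ab_group_add) dga \<Rightarrow> bool" where
  "is_dga A \<longleftrightarrow> is_cx A \<and> (\<forall>i<0. carr A i = {0})
     \<and> (\<forall>i j. \<forall>a\<in>carr A i. \<forall>b\<in>carr A j. mul A i j a b \<in> carr A (i + j))
     \<and> (\<forall>i j. \<forall>a\<in>carr A i. \<forall>a'\<in>carr A i. \<forall>b\<in>carr A j.
          mul A i j (a + a') b = mul A i j a b + mul A i j a' b)
     \<and> (\<forall>i j. \<forall>a\<in>carr A i. \<forall>b\<in>carr A j. \<forall>b'\<in>carr A j.
          mul A i j a (b + b') = mul A i j a b + mul A i j a b')
     \<and> (\<forall>r i j. \<forall>a\<in>carr A i. \<forall>b\<in>carr A j.
          mul A i j (smul A r a) b = smul A r (mul A i j a b)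
          \<and> mul A i j a (smul A r b) = smul A r (mul A i j a b))
     \<and> (\<forall>i j. \<forall>a\<in>carr A i. \<forall>b\<in>carr A j.
          dif A (i + j) (mul A i j a b)
            = mul A (i - 1) j (dif A i a) b + sgnact i (mul A i (j - 1) a (dif A j b)))
     \<and> (\<forall>i j k. \<forall>a\<in>carr A i. \<forall>b\<in>carr A j. \<forall>c\<in>carr A k.
          mul A (i + j) k (mul A i j a b) c = mul A i (j + k) a (mul A j k b c))
     \<and> one A \<in> carr A 0
     \<and> (\<forall>i. \<forall>a\<in>carr A i. mul A 0 i (one A) a = a \<and> mul A i 0 a (one A) = a)
     \<and> (\<forall>i j. \<forall>a\<in>carr A i. \<forall>b\<in>carr A j. mul A i j a b = sgnact (i * j) (mul A j i b a))
     \<and> (\<forall>i. odd i \<longrightarrow> (\<forall>a\<in>carr A i. mul A i i a a = 0))"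

definition is_dgm :: "('r::comm_ring_1, 'a::ab_group_add) dga \<Rightarrow> ('r, 'a, 'm::ab_group_add) dgm \<Rightarrow> bool" where
  "is_dgm A M \<longleftrightarrow> is_cx M
     \<and> (\<forall>i j. \<forall>a\<in>carr A i. \<forall>m\<in>carr M j. act M i j a m \<in> carr M (i + j))
     \<and> (\<forall>i j. \<forall>a\<in>carr A i. \<forall>a'\<in>carr A i. \<forall>m\<in>carr M j.
          act M i j (a + a') m = act M i j a m + act M i j a' m)
     \<and> (\<forall>i j. \<forall>a\<in>carr A i. \<forall>m\<in>carr M j. \<forall>m'\<in>carr M j.
          act M i j a (m + m') = act M i j a m + act M i j a m')
     \<and> (\<forall>r i j. \<forall>a\<in>carr A i. \<forall>m\<in>carr M j.
          act M i j (smul A r a) m = smul M r (act M i j a m)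
          \<and> act M i j a (smul M r m) = smul M r (act M i j a m))
     \<and> (\<forall>i j. \<forall>a\<in>carr A i. \<forall>m\<in>carr M j.
          dif M (i + j) (act M i j a m)
            = act M (i - 1) j (dif A i a) m + sgnact i (act M i (j - 1) a (dif M j m)))
     \<and> (\<forall>i j k. \<forall>a\<in>carr A i. \<forall>b\<in>carr A j. \<forall>m\<in>carr M k.
          act M (i + j) k (mul A i j a b) m = act M i (j + k) a (act M j k b m))
     \<and> (\<forall>j. \<forall>m\<in>carr M j. act M 0 j (one A) m = m)"

text \<open>Semi-basis: a family E j of homogeneous elements of degree j such that every element
  of M_n is uniquely a finite A-linear combination of them (basis of M^\<natural> over A^\<natural>).
  Basis elements are the pairs (j, e) with e \<in> E j.\<close>
definition semibasis :: "('r::comm_ring_1, 'a::ab_group_add) dga \<Rightarrow> ('r, 'a, 'm::ab_group_add) dgm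
    \<Rightarrow> (int \<Rightarrow> 'm set) \<Rightarrow> bool" where
  "semibasis A M E \<longleftrightarrow> (\<forall>j. E j \<subseteq> carr M j) \<and>
     (\<forall>n. \<forall>x\<in>carr M n. \<exists>!c :: int \<Rightarrow> 'm \<Rightarrow> 'a.
        finite {(j, e). e \<in> E j \<and> c j e \<noteq> 0}
        \<and> (\<forall>j e. e \<in> E j \<longrightarrow> c j e \<in> carr A (n - j))
        \<and> (\<forall>j e. e \<notin> E j \<longrightarrow> c j e = 0)
        \<and> x = (\<Sum>(j, e)\<in>{(j, e). e \<in> E j \<and> c j e \<noteq> 0}. act M (n - j) j (c j e) e))"

definition semifree :: "('r::comm_ring_1, 'a::ab_group_add) dga \<Rightarrow> ('r, 'a, 'm::ab_group_add) dgm \<Rightarrow> bool" where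
  "semifree A M \<longleftrightarrow> (\<exists>n0. \<forall>i<n0. carr M i = {0}) \<and> (\<exists>E. semibasis A M E)"

text \<open>B = K^R(t) \<otimes>_R A, written out: B_i = (1 \<otimes> A_i) \<oplus> (x \<otimes> A_(i-1)), an element
  (a0, a1) standing for 1 \<otimes> a0 + x \<otimes> a1, where x is the degree-1 generator with dx = t.\<close>
definition kos :: "('r::comm_ring_1, 'a::ab_group_add) dga \<Rightarrow> 'r \<Rightarrow> ('r, 'a \<times> 'a) dga" where
  "kos A t = \<lparr> carr = (\<lambda>i. carr A i \<times> carr A (i - 1)),
      smul = (\<lambda>r (a0, a1). (smul A r a0, smul A r a1)),
      dif = (\<lambda>i (a0, a1). (dif A i a0 + smul A t a1, - dif A (i - 1) a1)),
      mul = (\<lambda>i j (a0, a1) (b0, b1).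
               (mul A i j a0 b0, mul A (i - 1) j a1 b0 + sgnact i (mul A i (j - 1) a0 b1))),
      one = (one A, 0) \<rparr>"

text \<open>B \<otimes>_A M for a DG A-module M, written out via B^\<natural> = A^\<natural> 1 \<oplus> A^\<natural> x:
  (B \<otimes>_A M)_i = (1 \<otimes> M_i) \<oplus> (x \<otimes> M_(i-1)), with B acting by b(b' \<otimes> m) = (bb') \<otimes> m.\<close>
definition bchg :: "'r::comm_ring_1 \<Rightarrow> ('r, 'a::ab_group_add, 'm::ab_group_add) dgm
    \<Rightarrow> ('r, 'a \<times> 'a, 'm \<times> 'm) dgm" where
  "bchg t M = \<lparr> carr = (\<lambda>i. carr M i \<times> carr M (i - 1)),
      smul = (\<lambda>r (m0, m1). (smul M r m0, smul M r m1)),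
      dif = (\<lambda>i (m0, m1). (dif M i m0 + smul M t m1, - dif M (i - 1) m1)),
      act = (\<lambda>i j (a0, a1) (m0, m1).
               (act M i j a0 m0, act M (i - 1) j a1 m0 + sgnact i (act M i (j - 1) a0 m1))) \<rparr>"

definition dg_iso :: "('r::comm_ring_1, 'b::ab_group_add) dga \<Rightarrow> ('r, 'b, 'm::ab_group_add) dgm
    \<Rightarrow> ('r, 'b, 'p::ab_group_add) dgm \<Rightarrow> bool" where
  "dg_iso B M P \<longleftrightarrow> (\<exists>\<phi> :: int \<Rightarrow> 'm \<Rightarrow> 'p.
     (\<forall>i. rlin (smul M) (carr M i) (smul P) (carr P i) (\<phi> i) \<and> bij_betw (\<phi> i) (carr M i) (carr P i))
     \<and> (\<forall>i. \<forall>x\<in>carr M i. \<phi> (i - 1) (dif M i x) = dif P i (\<phi> i x))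
     \<and> (\<forall>i j. \<forall>b\<in>carr B i. \<forall>x\<in>carr M j. \<phi> (i + j) (act M i j b x) = act P i j b (\<phi> j x)))"

definition hom_set :: "('r::comm_ring_1, 'b::ab_group_add) dga \<Rightarrow> ('r, 'b, 'm::ab_group_add) dgm
    \<Rightarrow> ('r, 'b, 'p::ab_group_add) dgm \<Rightarrow> int \<Rightarrow> (int \<Rightarrow> 'm \<Rightarrow> 'p) set" where
  "hom_set B M P p = {f. (\<forall>i. rlin (smul M) (carr M i) (smul P) (carr P (i + p)) (f i))
     \<and> (\<forall>i j. \<forall>b\<in>carr B i. \<forall>x\<in>carr M j.
          f (i + j) (act M i j b x) = sgnact (p * i) (act P i (j + p) b (f j x)))}"

definition hom_d :: "('r, 'b, 'm::ab_group_add) dgm \<Rightarrow> ('r, 'b, 'p::ab_group_add) dgm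
    \<Rightarrow> int \<Rightarrow> (int \<Rightarrow> 'm \<Rightarrow> 'p) \<Rightarrow> (int \<Rightarrow> 'm \<Rightarrow> 'p)" where
  "hom_d M P p f = (\<lambda>i x. dif P (i + p) (f i x) - sgnact p (f (i - 1) (dif M i x)))"

text \<open>Ext^k_B(M,P) = H_(-k)(Hom_B(M,P)) = 0 (for M semi-free): every cycle of degree -k is a
  boundary. Maps are compared on the homogeneous components only.\<close>
definition ext_zero :: "('r::comm_ring_1, 'b::ab_group_add) dga \<Rightarrow> ('r, 'b, 'm::ab_group_add) dgm
    \<Rightarrow> ('r, 'b, 'p::ab_group_add) dgm \<Rightarrow> int \<Rightarrow> bool" where
  "ext_zero B M P k \<longleftrightarrow> (\<forall>f\<in>hom_set B M P (- k).
     (\<forall>i. \<forall>x\<in>carr M i. hom_d M P (- k) f i x = 0) \<longrightarrow>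
     (\<exists>g\<in>hom_set B M P (- k + 1). \<forall>i. \<forall>x\<in>carr M i. hom_d M P (- k + 1) g i x = f i x))"

end

theory Submission
  imports Defs
begin

text \<open>Write X for the degree-1 generator of the Koszul complex. As a graded module N = F + XF with F
  graded free over A, and its differential is determined by d f = \<alpha> f + X \<beta> f, where \<alpha> satisfies the
  Leibniz rule over A, \<beta> is A-linear of degree -2, \<alpha>\<alpha> + t\<beta> = 0 and \<alpha>\<beta> = \<beta>\<alpha>. If \<beta> = 0, then N is the
  base change of (F, \<alpha>). Conjugating d by 1 - X\<theta> replaces \<alpha> by \<alpha> + t\<theta> and \<beta> by
  \<beta> - \<alpha>\<theta> - \<theta>\<alpha> - t\<theta>\<theta>.

  Suppose \<beta> = t^n \<delta> with \<delta> commuting with \<alpha>. Then \<delta> extends to a cycle of degree -2 in Hom(N, N), so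
  it is the boundary of some g with g f = \<gamma> f + X \<epsilon> f, which means \<delta> = \<alpha>\<gamma> + \<gamma>\<alpha> + t\<epsilon> and
  \<alpha>\<epsilon> - \<epsilon>\<alpha> = \<beta>\<gamma> - \<gamma>\<beta>. Conjugation with \<theta> = t^n \<gamma> turns \<beta> into
  t^(n+1) (\<epsilon> - t^n \<gamma>\<gamma>), and \<epsilon> - t^n \<gamma>\<gamma> commutes with the new \<alpha>; no division by t is needed. The
  total conjugation is by 1 - X \<Sum> t^n \<gamma>_n, which converges because the components of F are products
  of complete modules, and in the limit \<beta> is divisible by every power of t, hence zero.\<close>

section \<open>Graded modules and invariance of Ext\<close>

text \<open>Since t may be a zero divisor, the equation \<beta> = t^n \<delta> determines neither
  \<delta> nor its commutation with \<alpha>. Both are therefore carried along as data, and the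
  vanishing of Ext is applied to \<delta> rather than to \<beta>. That vanishing is given for N
  only, while every step uses it for a conjugated differential; hence the invariance of Ext under
  isomorphism. Successive conjugations compose additively because X X = 0, which is why their
  infinite composite is governed by a series. Finiteness enters through the choice of F: A lives in
  nonnegative degrees, N is bounded below, and the semi-basis is finite in each degree, so only
  finitely many basis elements matter in a given degree. Coefficient functions without any support
  condition, for which limits can be taken coordinate by coordinate, are then the same as finite
  linear combinations.\<close>

lemma sgnact_even [simp]: "even k \<Longrightarrow> sgnact k x = x"
  and sgnact_odd [simp]: "odd k \<Longrightarrow> sgnact k x = - x"
  by (simp_all add: sgnact_def)

lemma sgnact_add: "sgnact k (x + y) = sgnact k x + sgnact k y"
  and sgnact_diff: "sgnact k (x - y) = sgnact k x - sgnact k y"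
  and sgnact_zero [simp]: "sgnact k 0 = 0"
  and sgnact_sgnact [simp]: "sgnact k (sgnact k x) = x"
  and sgnact_uminus [simp]: "sgnact (- k) x = sgnact k x"
  and sgnact_Pair: "sgnact k (u, v) = (sgnact k u, sgnact k v)"
  and sgnact_apply: "sgnact k f z = sgnact k (f z)"
  by (simp_all add: sgnact_def)

text \<open>Differentials are left out on purpose: the facts below are also applied to
  \<open>coord_mod\<close>, whose differential is a placeholder, and to twisted modules, where
  \<alpha> alone does not square to zero.\<close>

locale graded_rmod =
  fixes M :: "('r::comm_ring_1, 'm::ab_group_add, 'z) cx_scheme"
  assumes rmod_carr: "rmod (smul M) (carr M i)"
begin

lemma zero_mem [simp]: "0 \<in> carr M i"
  and add_mem [simp]: "x \<in> carr M i \<Longrightarrow> y \<in> carr M i \<Longrightarrow> x + y \<in> carr M i"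
  and uminus_mem [simp]: "x \<in> carr M i \<Longrightarrow> - x \<in> carr M i"
  and smul_mem [simp]: "x \<in> carr M i \<Longrightarrow> smul M r x \<in> carr M i"
  and smul_add: "x \<in> carr M i \<Longrightarrow> y \<in> carr M i \<Longrightarrow> smul M r (x + y) = smul M r x + smul M r y"
  and add_smul: "x \<in> carr M i \<Longrightarrow> smul M (r + s) x = smul M r x + smul M s x"
  and smul_smul: "x \<in> carr M i \<Longrightarrow> smul M r (smul M s x) = smul M (r * s) x"
  and smul_one: "x \<in> carr M i \<Longrightarrow> smul M 1 x = x"
  using rmod_carr[of i] unfolding rmod_def by auto

lemma diff_mem [simp]: "x \<in> carr M i \<Longrightarrow> y \<in> carr M i \<Longrightarrow> x - y \<in> carr M i"
  using add_mem[of x i "- y"] by simp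

lemma sgnact_mem [simp]: "x \<in> carr M i \<Longrightarrow> sgnact k x \<in> carr M i"
  by (simp add: sgnact_def)

lemma sum_mem: "(\<And>k. k \<in> K \<Longrightarrow> f k \<in> carr M i) \<Longrightarrow> sum f K \<in> carr M i"
  by (induction K rule: infinite_finite_induct) auto

lemma smul_zero [simp]: "smul M r 0 = 0"
  using smul_add[of 0 0 0 r] by simp

lemma smul_uminus: "x \<in> carr M i \<Longrightarrow> smul M r (- x) = - smul M r x"
  using smul_add[of x i "- x" r] by (simp add: minus_unique)

lemma smul_diff: "x \<in> carr M i \<Longrightarrow> y \<in> carr M i \<Longrightarrow> smul M r (x - y) = smul M r x - smul M r y"
  using smul_add[of x i "- y" r] smul_uminus[of y i r] by simp

lemma smul_sgnact: "x \<in> carr M i \<Longrightarrow> smul M r (sgnact k x) = sgnact k (smul M r x)"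
  by (simp add: sgnact_def smul_uminus)

lemma smul_sum:
  "(\<And>k. k \<in> K \<Longrightarrow> f k \<in> carr M i) \<Longrightarrow> smul M r (sum f K) = (\<Sum>k\<in>K. smul M r (f k))"
  by (induction K rule: infinite_finite_induct) (auto simp: smul_add[of _ i] sum_mem)

lemma zero_smul: "x \<in> carr M i \<Longrightarrow> smul M 0 x = 0"
  using add_smul[of x i 0 0] by simp

end

lemma rlin_zero: "rlin sm S sn T f \<Longrightarrow> 0 \<in> S \<Longrightarrow> f 0 = 0"
proof -
  assume "rlin sm S sn T f" "0 \<in> S"
  then have "f (0 + 0) = f 0 + f 0" unfolding rlin_def by blast
  then show ?thesis by simp
qed

lemma rlin_uminus:
  assumes "rlin sm S sn T f" "rmod sm S" "x \<in> S" shows "f (- x) = - f x"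
proof -
  have "- x \<in> S" "0 \<in> S" using assms by (auto simp: rmod_def)
  then have "f (x + - x) = f x + f (- x)" using assms(1,3) unfolding rlin_def by blast
  moreover have "f (x + - x) = 0" using rlin_zero[OF assms(1)] \<open>0 \<in> S\<close> by simp
  ultimately show ?thesis by (simp add: eq_neg_iff_add_eq_0 add.commute)
qed

lemma rlin_mem: "rlin sm S sn T f \<Longrightarrow> x \<in> S \<Longrightarrow> f x \<in> T"
  and rlin_add: "rlin sm S sn T f \<Longrightarrow> x \<in> S \<Longrightarrow> y \<in> S \<Longrightarrow> f (x + y) = f x + f y"
  and rlin_smul: "rlin sm S sn T f \<Longrightarrow> x \<in> S \<Longrightarrow> f (sm r x) = sn r (f x)"
  unfolding rlin_def by auto

lemma rlin_sgnact:
  "rlin sm S sn T f \<Longrightarrow> rmod sm S \<Longrightarrow> x \<in> S \<Longrightarrow> f (sgnact k x) = sgnact k (f x)"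
  by (simp add: sgnact_def rlin_uminus)

lemma rlin_diff:
  assumes "rlin sm S sn T f" "rmod sm S" "x \<in> S" "y \<in> S" shows "f (x - y) = f x - f y"
proof -
  have "- y \<in> S" using assms by (auto simp: rmod_def)
  then show ?thesis
    using rlin_add[OF assms(1), of x "- y"] rlin_uminus[OF assms(1,2), of y] assms by simp
qed

text \<open>This is the part of a DG module structure that does not mention differentials.
  Membership in \<open>hom_set\<close> depends on nothing more, so graded homomorphisms of F can be
  handled before F has a differential.\<close>

locale graded_act = graded_rmod M
  for M :: "('r::comm_ring_1, 'b::ab_group_add, 'm::ab_group_add) dgm" +
  fixes B :: "('r, 'b) dga"
  assumes rmod_alg: "rmod (smul B) (carr B i)"
    and act_mem': "a \<in> carr B i \<Longrightarrow> x \<in> carr M j \<Longrightarrow> act M i j a x \<in> carr M (i + j)"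
    and act_add_left: "a \<in> carr B i \<Longrightarrow> a' \<in> carr B i \<Longrightarrow> x \<in> carr M j \<Longrightarrow>
      act M i j (a + a') x = act M i j a x + act M i j a' x"
    and act_add_right: "a \<in> carr B i \<Longrightarrow> x \<in> carr M j \<Longrightarrow> y \<in> carr M j \<Longrightarrow>
      act M i j a (x + y) = act M i j a x + act M i j a y"
    and act_smul_left: "a \<in> carr B i \<Longrightarrow> x \<in> carr M j \<Longrightarrow>
      act M i j (smul B r a) x = smul M r (act M i j a x)"
    and act_smul_right: "a \<in> carr B i \<Longrightarrow> x \<in> carr M j \<Longrightarrow>
      act M i j a (smul M r x) = smul M r (act M i j a x)"
    and act_act: "a \<in> carr B i \<Longrightarrow> b \<in> carr B j \<Longrightarrow> x \<in> carr M k \<Longrightarrow>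
      act M i (j + k) a (act M j k b x) = act M (i + j) k (mul B i j a b) x"
    and act_one: "x \<in> carr M j \<Longrightarrow> act M 0 j (one B) x = x"
begin

sublocale alg: graded_rmod B
  by unfold_locales (rule rmod_alg)

lemma act_mem [simp]:
  "a \<in> carr B i \<Longrightarrow> x \<in> carr M j \<Longrightarrow> k = i + j \<Longrightarrow> act M i j a x \<in> carr M k"
  using act_mem' by simp

lemma act_zero_right [simp]: "a \<in> carr B i \<Longrightarrow> act M i j a 0 = 0"
  using act_add_right[of a i 0 j 0] by simp

lemma act_zero_left [simp]: "x \<in> carr M j \<Longrightarrow> act M i j 0 x = 0"
  using act_add_left[of 0 i 0 x j] by simp

lemma act_uminus_right: "a \<in> carr B i \<Longrightarrow> x \<in> carr M j \<Longrightarrow> act M i j a (- x) = - act M i j a x"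
  using act_add_right[of a i x j "- x"] by (simp add: minus_unique)

lemma act_diff_right: "a \<in> carr B i \<Longrightarrow> x \<in> carr M j \<Longrightarrow> y \<in> carr M j \<Longrightarrow>
    act M i j a (x - y) = act M i j a x - act M i j a y"
  using act_add_right[of a i x j "- y"] act_uminus_right[of a i y j] by simp

lemma act_sum_right: "a \<in> carr B i \<Longrightarrow> (\<And>k. k \<in> K \<Longrightarrow> f k \<in> carr M j) \<Longrightarrow>
    act M i j a (sum f K) = (\<Sum>k\<in>K. act M i j a (f k))"
  by (induction K rule: infinite_finite_induct) (auto simp: act_add_right sum_mem)

end

section \<open>Morphisms of DG modules and transport of Ext along isomorphisms\<close>

definition dg_hom :: "('r::comm_ring_1, 'b::ab_group_add) dga \<Rightarrow> ('r, 'b, 'm::ab_group_add) dgm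
    \<Rightarrow> ('r, 'b, 'p::ab_group_add) dgm \<Rightarrow> (int \<Rightarrow> 'm \<Rightarrow> 'p) \<Rightarrow> bool" where
  "dg_hom B M P \<phi> \<longleftrightarrow> (\<forall>i. rlin (smul M) (carr M i) (smul P) (carr P i) (\<phi> i))
     \<and> (\<forall>i. \<forall>x\<in>carr M i. \<phi> (i - 1) (dif M i x) = dif P i (\<phi> i x))
     \<and> (\<forall>i j. \<forall>b\<in>carr B i. \<forall>x\<in>carr M j. \<phi> (i + j) (act M i j b x) = act P i j b (\<phi> j x))"

lemma dg_iso_iff: "dg_iso B M P \<longleftrightarrow>
    (\<exists>\<phi>. dg_hom B M P \<phi> \<and> (\<forall>i. bij_betw (\<phi> i) (carr M i) (carr P i)))"
  unfolding dg_iso_def dg_hom_def all_conj_distrib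
  by (intro arg_cong[where f = Ex] ext) (simp only: conj_ac)

lemma dg_isoI: "dg_hom B M P \<phi> \<Longrightarrow> (\<And>i. bij_betw (\<phi> i) (carr M i) (carr P i)) \<Longrightarrow> dg_iso B M P"
  unfolding dg_iso_iff by auto

lemma dg_hom_comp:
  assumes "dg_hom B M P \<phi>" "dg_hom B P Q \<psi>" shows "dg_hom B M Q (\<lambda>i x. \<psi> i (\<phi> i x))"
  using assms unfolding dg_hom_def rlin_def by simp

lemma dg_iso_trans: "dg_iso B M P \<Longrightarrow> dg_iso B P Q \<Longrightarrow> dg_iso B M Q"
  unfolding dg_iso_iff
proof (elim exE conjE)
  fix \<phi> \<psi>
  assume "dg_hom B M P \<phi>" "\<forall>i. bij_betw (\<phi> i) (carr M i) (carr P i)"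
    and "dg_hom B P Q \<psi>" "\<forall>i. bij_betw (\<psi> i) (carr P i) (carr Q i)"
  then show "\<exists>\<chi>. dg_hom B M Q \<chi> \<and> (\<forall>i. bij_betw (\<chi> i) (carr M i) (carr Q i))"
    using dg_hom_comp[of B M P \<phi> Q \<psi>] bij_betw_trans[unfolded comp_def] by blast
qed

text \<open>Every element of P is some \<open>\<phi> i x\<close>, so each identity for the inverse
  is the identity for \<phi> read backwards. Stability of M under differential and action is what
  lets the inverse cancel \<phi> there.\<close>

lemma dg_hom_inverse:
  assumes "dg_hom B M P \<phi>" and bij: "\<And>i. bij_betw (\<phi> i) (carr M i) (carr P i)"
    and M: "\<And>i. rmod (smul M) (carr M i)"
    and dif: "\<And>i x. x \<in> carr M i \<Longrightarrow> dif M i x \<in> carr M (i - 1)"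
    and act: "\<And>i j b x. b \<in> carr B i \<Longrightarrow> x \<in> carr M j \<Longrightarrow> act M i j b x \<in> carr M (i + j)"
  shows "dg_hom B P M (\<lambda>i. inv_into (carr M i) (\<phi> i))"
proof -
  interpret graded_rmod M by unfold_locales (rule M)
  let ?\<psi> = "\<lambda>i. inv_into (carr M i) (\<phi> i)"
  have \<psi>\<phi>: "?\<psi> i (\<phi> i x) = x" if "x \<in> carr M i" for i x
    using bij_betw_inv_into_left[OF bij that] .
  have surj: "\<exists>x\<in>carr M i. y = \<phi> i x" if "y \<in> carr P i" for i y
    using bij[of i] that by (auto simp: bij_betw_def)
  have lin: "rlin (smul M) (carr M i) (smul P) (carr P i) (\<phi> i)" for i
    using assms(1) by (simp add: dg_hom_def)
  have "rlin (smul P) (carr P i) (smul M) (carr M i) (?\<psi> i)" for i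
    unfolding rlin_def
  proof (intro conjI ballI allI)
    fix y assume "y \<in> carr P i"
    then obtain x where x: "x \<in> carr M i" "y = \<phi> i x" using surj by blast
    then show "?\<psi> i y \<in> carr M i" by (simp add: \<psi>\<phi>)
    show "?\<psi> i (smul P r y) = smul M r (?\<psi> i y)" for r
      using \<psi>\<phi>[of "smul M r x" i] rlin_smul[OF lin, of x i r] x by (simp add: \<psi>\<phi>)
    fix y' assume "y' \<in> carr P i"
    then obtain x' where x': "x' \<in> carr M i" "y' = \<phi> i x'" using surj by blast
    show "?\<psi> i (y + y') = ?\<psi> i y + ?\<psi> i y'"
      using \<psi>\<phi>[of "x + x'" i] rlin_add[OF lin, of x i x'] x x' by (simp add: \<psi>\<phi>)
  qed
  moreover have "?\<psi> (i - 1) (dif P i y) = dif M i (?\<psi> i y)" if y: "y \<in> carr P i" for i y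
  proof -
    obtain x where x: "x \<in> carr M i" "y = \<phi> i x" using surj y by blast
    then have "dif P i y = \<phi> (i - 1) (dif M i x)" using assms(1) by (simp add: dg_hom_def)
    then show ?thesis using x dif by (simp add: \<psi>\<phi>)
  qed
  moreover have "?\<psi> (i + j) (act P i j b y) = act M i j b (?\<psi> j y)"
    if b: "b \<in> carr B i" and y: "y \<in> carr P j" for i j b y
  proof -
    obtain x where x: "x \<in> carr M j" "y = \<phi> j x" using surj y by blast
    then have "act P i j b y = \<phi> (i + j) (act M i j b x)" using assms(1) b by (simp add: dg_hom_def)
    then show ?thesis using x b act by (simp add: \<psi>\<phi>)
  qed
  ultimately show ?thesis unfolding dg_hom_def by blast
qed

lemma dg_iso_sym:
  assumes "dg_iso B M P" and "\<And>i. rmod (smul M) (carr M i)"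
    and "\<And>i x. x \<in> carr M i \<Longrightarrow> dif M i x \<in> carr M (i - 1)"
    and "\<And>i j b x. b \<in> carr B i \<Longrightarrow> x \<in> carr M j \<Longrightarrow> act M i j b x \<in> carr M (i + j)"
  shows "dg_iso B P M"
proof -
  obtain \<phi> where "dg_hom B M P \<phi>" "\<And>i. bij_betw (\<phi> i) (carr M i) (carr P i)"
    using assms(1) by (auto simp: dg_iso_iff)
  then show ?thesis
    using dg_isoI[OF dg_hom_inverse[OF _ _ assms(2-4)] bij_betw_inv_into] by blast
qed

text \<open>Both maps have degree 0 and commute with the action without sign, so the sign rule of
  \<open>f\<close> is passed on unchanged. The lemma serves once from P to M and once back.\<close>

lemma hom_set_transport:
  assumes \<phi>: "dg_hom B M P \<phi>" and \<psi>: "dg_hom B P M \<psi>" and f: "f \<in> hom_set B P P p"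
    and P: "\<And>i. rmod (smul P) (carr P i)"
    and act: "\<And>i j b x. b \<in> carr B i \<Longrightarrow> x \<in> carr P j \<Longrightarrow> act P i j b x \<in> carr P (i + j)"
  shows "(\<lambda>i x. \<psi> (i + p) (f i (\<phi> i x))) \<in> hom_set B M M p"
proof -
  have lin: "rlin (smul M) (carr M i) (smul P) (carr P i) (\<phi> i)"
    "rlin (smul P) (carr P i) (smul M) (carr M i) (\<psi> i)"
    "rlin (smul P) (carr P i) (smul P) (carr P (i + p)) (f i)" for i
    using assms by (auto simp: dg_hom_def hom_set_def)
  have "\<psi> (i + j + p) (f (i + j) (\<phi> (i + j) (act M i j b x))) =
      sgnact (p * i) (act M i (j + p) b (\<psi> (j + p) (f j (\<phi> j x))))"
    if b: "b \<in> carr B i" and x: "x \<in> carr M j" for i j b x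
  proof -
    have m: "\<phi> j x \<in> carr P j" "f j (\<phi> j x) \<in> carr P (j + p)"
      using lin x by (auto simp: rlin_def)
    have "\<psi> (i + j + p) (f (i + j) (\<phi> (i + j) (act M i j b x)))
        = \<psi> (i + j + p) (f (i + j) (act P i j b (\<phi> j x)))"
      using \<phi> b x by (simp add: dg_hom_def)
    also have "\<dots> = \<psi> (i + j + p) (sgnact (p * i) (act P i (j + p) b (f j (\<phi> j x))))"
      using f b m by (simp add: hom_set_def)
    also have "\<dots> = sgnact (p * i) (\<psi> (i + j + p) (act P i (j + p) b (f j (\<phi> j x))))"
      using act[OF b m(2)] by (subst rlin_sgnact[OF lin(2) P]) (auto simp: add.assoc)
    also have "\<psi> (i + j + p) (act P i (j + p) b (f j (\<phi> j x)))
        = act M i (j + p) b (\<psi> (j + p) (f j (\<phi> j x)))"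
      using \<psi> b m(2) by (simp add: dg_hom_def add.assoc)
    finally show ?thesis .
  qed
  moreover have "rlin (smul M) (carr M i) (smul M) (carr M (i + p)) (\<lambda>x. \<psi> (i + p) (f i (\<phi> i x)))" for i
    using lin unfolding rlin_def by simp
  ultimately show ?thesis unfolding hom_set_def by simp
qed

lemma hom_d_transport:
  assumes \<phi>: "dg_hom B M P \<phi>" and \<psi>: "dg_hom B P M \<psi>" and f: "f \<in> hom_set B P P p"
    and P: "\<And>i. rmod (smul P) (carr P i)"
    and dif: "\<And>i x. x \<in> carr P i \<Longrightarrow> dif P i x \<in> carr P (i - 1)"
    and x: "x \<in> carr M i"
  shows "hom_d M M p (\<lambda>i x. \<psi> (i + p) (f i (\<phi> i x))) i x = \<psi> (i + p - 1) (hom_d P P p f i (\<phi> i x))"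
proof -
  interpret graded_rmod P by unfold_locales (rule P)
  have lin: "rlin (smul M) (carr M i) (smul P) (carr P i) (\<phi> i)"
    "rlin (smul P) (carr P i) (smul M) (carr M i) (\<psi> i)"
    "rlin (smul P) (carr P i) (smul P) (carr P (i + p)) (f i)" for i
    using assms by (auto simp: dg_hom_def hom_set_def)
  have m: "\<phi> i x \<in> carr P i" "f i (\<phi> i x) \<in> carr P (i + p)"
    using lin x by (auto simp: rlin_def)
  have m': "dif P i (\<phi> i x) \<in> carr P (i - 1)" "dif P (i + p) (f i (\<phi> i x)) \<in> carr P (i + p - 1)"
    using dif m by auto
  have m'': "f (i - 1) (dif P i (\<phi> i x)) \<in> carr P (i + p - 1)"
    using rlin_mem[OF lin(3) m'(1)] by (simp add: algebra_simps)
  have "\<phi> (i - 1) (dif M i x) = dif P i (\<phi> i x)"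
    using \<phi> x by (simp add: dg_hom_def)
  moreover have "dif M (i + p) (\<psi> (i + p) (f i (\<phi> i x))) = \<psi> (i + p - 1) (dif P (i + p) (f i (\<phi> i x)))"
    using \<psi> m by (simp add: dg_hom_def)
  moreover have "\<psi> (i - 1 + p) = \<psi> (i + p - 1)" by (simp add: algebra_simps)
  ultimately show ?thesis
    using m' m'' by (simp add: hom_d_def rlin_diff[OF lin(2) P] rlin_sgnact[OF lin(2) P])
qed

text \<open>A cycle on P is carried over to M, bounded there by some g, and g is carried back; that
  \<psi> is a right inverse of \<phi> returns the original cycle.\<close>

lemma ext_zero_dg_iso:
  assumes iso: "dg_iso B M P" and ext: "ext_zero B M M k"
    and M: "\<And>i. rmod (smul M) (carr M i)"
    and difM: "\<And>i x. x \<in> carr M i \<Longrightarrow> dif M i x \<in> carr M (i - 1)"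
    and actM: "\<And>i j b x. b \<in> carr B i \<Longrightarrow> x \<in> carr M j \<Longrightarrow> act M i j b x \<in> carr M (i + j)"
    and P: "\<And>i. rmod (smul P) (carr P i)"
    and difP: "\<And>i x. x \<in> carr P i \<Longrightarrow> dif P i x \<in> carr P (i - 1)"
    and actP: "\<And>i j b x. b \<in> carr B i \<Longrightarrow> x \<in> carr P j \<Longrightarrow> act P i j b x \<in> carr P (i + j)"
  shows "ext_zero B P P k"
proof -
  obtain \<phi> where \<phi>: "dg_hom B M P \<phi>" and bij: "\<And>i. bij_betw (\<phi> i) (carr M i) (carr P i)"
    using iso by (auto simp: dg_iso_iff)
  define \<psi> where "\<psi> = (\<lambda>i. inv_into (carr M i) (\<phi> i))"
  have \<psi>: "dg_hom B P M \<psi>" unfolding \<psi>_def by (rule dg_hom_inverse[OF \<phi> bij M difM actM])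
  have \<psi>mem: "\<psi> i x \<in> carr M i" and \<phi>\<psi>: "\<phi> i (\<psi> i x) = x" if "x \<in> carr P i" for i x
    using \<psi> that bij_betw_inv_into_right[OF bij that]
    by (auto simp: \<psi>_def dg_hom_def rlin_def)
  show ?thesis unfolding ext_zero_def
  proof (intro ballI impI)
    fix f assume f: "f \<in> hom_set B P P (- k)"
      and cyc: "\<forall>i. \<forall>x\<in>carr P i. hom_d P P (- k) f i x = 0"
    let ?f = "\<lambda>i x. \<psi> (i + - k) (f i (\<phi> i x))"
    have "?f \<in> hom_set B M M (- k)" by (rule hom_set_transport[OF \<phi> \<psi> f P actP])
    moreover have "hom_d M M (- k) ?f i x = 0" if "x \<in> carr M i" for i x
    proof -
      have "\<phi> i x \<in> carr P i" using \<phi> that by (auto simp: dg_hom_def rlin_def)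
      moreover have "\<psi> (i + - k - 1) 0 = 0"
        using \<psi> P by (intro rlin_zero) (auto simp: dg_hom_def rmod_def)
      ultimately show ?thesis
        using hom_d_transport[OF \<phi> \<psi> f P difP that] cyc by simp
    qed
    ultimately obtain g where g: "g \<in> hom_set B M M (- k + 1)"
      and gf: "\<And>i x. x \<in> carr M i \<Longrightarrow> hom_d M M (- k + 1) g i x = ?f i x"
      using ext unfolding ext_zero_def by blast
    let ?g = "\<lambda>i x. \<phi> (i + (- k + 1)) (g i (\<psi> i x))"
    have "?g \<in> hom_set B P P (- k + 1)" by (rule hom_set_transport[OF \<psi> \<phi> g M actM])
    moreover have "hom_d P P (- k + 1) ?g i x = f i x" if x: "x \<in> carr P i" for i x
    proof -
      have "f i x \<in> carr P (i - k)" using f x by (auto simp: hom_set_def rlin_def)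
      then show ?thesis
        using hom_d_transport[OF \<psi> \<phi> g M difM x] gf[OF \<psi>mem[OF x]] \<phi>\<psi> x by simp
    qed
    ultimately show "\<exists>g\<in>hom_set B P P (- k + 1). \<forall>i. \<forall>x\<in>carr P i. hom_d P P (- k + 1) g i x = f i x"
      by blast
  qed
qed

section \<open>Adic limits\<close>

text \<open>Convergence of power series in t with coefficients in \<open>S\<close>, together with
  separatedness. The series form is chosen over Cauchy sequences because the corrections in the
  iteration arrive as \<open>t ^ n\<close> times a map.\<close>

definition tadic_complete :: "'r::comm_ring_1 \<Rightarrow> ('r \<Rightarrow> 'm::ab_group_add \<Rightarrow> 'm) \<Rightarrow> 'm set \<Rightarrow> bool" where
  "tadic_complete t sm S \<longleftrightarrow>
    (\<forall>y. (\<forall>n. y n \<in> S) \<longrightarrow>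
      (\<exists>s\<in>S. \<forall>n. \<exists>z\<in>S. s - (\<Sum>m<n. sm (t ^ m) (y m)) = sm (t ^ n) z))
    \<and> (\<forall>u\<in>S. (\<forall>n. \<exists>z\<in>S. u = sm (t ^ n) z) \<longrightarrow> u = 0)"

lemma ex1_unique: "\<exists>!x. P x \<Longrightarrow> P a \<Longrightarrow> P b \<Longrightarrow> a = b"
  by blast

context graded_rmod
begin

lemma uminus_smul: "x \<in> carr M i \<Longrightarrow> smul M (- r) x = - smul M r x"
  using add_smul[of x i r "- r"] zero_smul[of x i] by (simp add: minus_unique)

lemma diff_smul: "x \<in> carr M i \<Longrightarrow> smul M (r - s) x = smul M r x - smul M s x"
  using add_smul[of x i r "- s"] uminus_smul[of x i s] by simp

lemma sum_smul: "x \<in> carr M i \<Longrightarrow> smul M (sum c K) x = (\<Sum>k\<in>K. smul M (c k) x)"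
  by (induction K rule: infinite_finite_induct) (auto simp: add_smul zero_smul)

lemma smul_lincomb:
  assumes "\<And>k. k \<in> K \<Longrightarrow> e k \<in> carr M i"
  shows "smul M r (\<Sum>k\<in>K. smul M (c k) (e k)) = (\<Sum>k\<in>K. smul M (r * c k) (e k))"
  using assms by (subst smul_sum[of _ _ i]) (auto simp: smul_smul[of _ i])

text \<open>A finite basis reduces both halves to R. Limits are taken in each coordinate, and
  uniqueness of coordinates transfers divisibility by \<open>t ^ N\<close> from an element to its
  coordinates.\<close>

lemma tadic_complete_free:
  assumes R: "adic_complete t" and free: "free_fin_rank (smul M) (carr M i)"
  shows "tadic_complete t (smul M) (carr M i)"
proof -
  obtain e and n :: nat where "(\<forall>k<n. e k \<in> carr M i) \<and> (\<forall>x\<in>carr M i.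
      \<exists>!c. (\<forall>k\<ge>n. c k = 0) \<and> x = (\<Sum>k<n. smul M (c k) (e k)))"
    using free unfolding free_fin_rank_def by (elim exE)
  then have e: "k < n \<Longrightarrow> e k \<in> carr M i" and coord: "x \<in> carr M i \<Longrightarrow>
      \<exists>!c. (\<forall>k\<ge>n. c k = 0) \<and> x = (\<Sum>k<n. smul M (c k) (e k))" for k x
    by simp_all
  show ?thesis unfolding tadic_complete_def
  proof (intro conjI allI impI ballI)
    fix y :: "nat \<Rightarrow> 'm" assume y: "\<forall>m. y m \<in> carr M i"
    then have "\<exists>c. y m = (\<Sum>k<n. smul M (c k) (e k))" for m
      using ex1_implies_ex[OF coord[of "y m"]] by auto
    then have "\<exists>c. \<forall>m. y m = (\<Sum>k<n. smul M (c m k) (e k))"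
      by (intro choice allI)
    then obtain c where c: "\<And>m. y m = (\<Sum>k<n. smul M (c m k) (e k))" by blast
    \<comment> \<open>Partial sums in the k-th coordinate. Consecutive ones differ by a multiple of
      \<open>t ^ N\<close>, so they form a compatible sequence in R.\<close>
    define X where "X = (\<lambda>k N. \<Sum>m<N. t ^ m * c m k)"
    have "\<exists>Y. \<forall>k N. \<exists>r. Y k - X k N = t ^ N * r"
    proof (intro choice allI)
      fix k
      have "\<forall>N. \<exists>r. X k (Suc N) - X k N = t ^ N * r" by (auto simp: X_def)
      then have "\<exists>!s. \<forall>N. \<exists>r. s - X k N = t ^ N * r" using R unfolding adic_complete_def by simp
      then show "\<exists>s. \<forall>N. \<exists>r. s - X k N = t ^ N * r" by (rule ex1_implies_ex)
    qed
    then obtain Y where Y: "\<And>k N. \<exists>r. Y k - X k N = t ^ N * r" by blast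
    show "\<exists>s\<in>carr M i. \<forall>N. \<exists>z\<in>carr M i. s - (\<Sum>m<N. smul M (t ^ m) (y m)) = smul M (t ^ N) z"
    proof (rule bexI[of _ "\<Sum>k<n. smul M (Y k) (e k)"], rule allI)
      fix N
      obtain r where r: "\<And>k. Y k - X k N = t ^ N * r k" using Y[of _ N] by metis
      have "(\<Sum>m<N. smul M (t ^ m) (y m)) = (\<Sum>m<N. \<Sum>k<n. smul M (t ^ m * c m k) (e k))"
        unfolding c by (intro sum.cong refl smul_lincomb[where i = i] e) simp
      also have "\<dots> = (\<Sum>k<n. smul M (X k N) (e k))"
        by (subst sum.swap) (auto simp: X_def sum_smul[of _ i] e intro!: sum.cong)
      finally have "(\<Sum>k<n. smul M (Y k) (e k)) - (\<Sum>m<N. smul M (t ^ m) (y m))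
          = (\<Sum>k<n. smul M (Y k - X k N) (e k))"
        by (auto simp: sum_subtractf[symmetric] diff_smul[of _ i] e intro!: sum.cong)
      also have "\<dots> = smul M (t ^ N) (\<Sum>k<n. smul M (r k) (e k))"
        unfolding r by (rule smul_lincomb[where i = i, symmetric]) (simp add: e)
      finally show "\<exists>z\<in>carr M i. (\<Sum>k<n. smul M (Y k) (e k)) - (\<Sum>m<N. smul M (t ^ m) (y m))
          = smul M (t ^ N) z"
        using e by (intro bexI[of _ "\<Sum>k<n. smul M (r k) (e k)"] sum_mem) auto
    qed (use e in \<open>auto intro!: sum_mem\<close>)
  next
    fix u assume u: "u \<in> carr M i" "\<forall>N. \<exists>z\<in>carr M i. u = smul M (t ^ N) z"
    obtain c where c: "\<forall>k\<ge>n. c k = 0" "u = (\<Sum>k<n. smul M (c k) (e k))"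
      using ex1_implies_ex[OF coord[OF u(1)]] by auto
    have "\<exists>r. c k - 0 = t ^ N * r" for k N
    proof -
      obtain z where z: "z \<in> carr M i" "u = smul M (t ^ N) z" using u by blast
      obtain d where d: "\<forall>k\<ge>n. d k = 0" "z = (\<Sum>k<n. smul M (d k) (e k))"
        using ex1_implies_ex[OF coord[OF z(1)]] by auto
      have "u = (\<Sum>k<n. smul M (t ^ N * d k) (e k))"
        unfolding z(2) d(2) by (intro smul_lincomb[where i = i] e) simp
      moreover have "\<forall>k\<ge>n. t ^ N * d k = 0" using d by simp
      ultimately have "c = (\<lambda>k. t ^ N * d k)" using c by (intro ex1_unique[OF coord[OF u(1)]] conjI)
      then show ?thesis by auto
    qed
    \<comment> \<open>Completeness applied to the zero sequence: only 0 is divisible by all powers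
      of t in R.\<close>
    moreover have "\<exists>!y. \<forall>N. \<exists>r. y - 0 = t ^ N * r"
      by (rule R[unfolded adic_complete_def, rule_format, of "\<lambda>_. 0"]) (rule exI[of _ 0], simp)
    moreover have "\<forall>N. \<exists>r. 0 - 0 = t ^ N * r" by (auto intro!: exI[of _ 0])
    ultimately have "c k = 0" for k by (intro ex1_unique[of "\<lambda>y. \<forall>N. \<exists>r. y - 0 = t ^ N * r"]) simp_all
    then show "u = 0" using c e by (auto simp: zero_smul[of _ i])
  qed
qed

section \<open>Congruence modulo powers of t and limits of homomorphisms\<close>

definition tcong where
  "tcong t n i x y \<longleftrightarrow> (\<exists>z\<in>carr M i. x - y = smul M (t ^ n) z)"

lemma tcong_refl: "tcong t n i x x"
  unfolding tcong_def by (intro bexI[of _ 0]) auto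

lemma tcong_sym: "tcong t n i x y \<Longrightarrow> tcong t n i y x"
  unfolding tcong_def by (elim bexE, rule_tac x = "- z" in bexI) (auto simp: smul_uminus algebra_simps)

lemma tcong_add: "tcong t n i x y \<Longrightarrow> tcong t n i x' y' \<Longrightarrow> tcong t n i (x + x') (y + y')"
  unfolding tcong_def
  by (elim bexE, rule_tac x = "z + za" in bexI) (auto simp: smul_add algebra_simps)

lemma tcong_diff: "tcong t n i x y \<Longrightarrow> tcong t n i x' y' \<Longrightarrow> tcong t n i (x - x') (y - y')"
  unfolding tcong_def
  by (elim bexE, rule_tac x = "z - za" in bexI) (auto simp: smul_diff algebra_simps)

lemma tcong_trans: "tcong t n i x y \<Longrightarrow> tcong t n i y z \<Longrightarrow> tcong t n i x z"
  using tcong_add[of t n i x y y z] unfolding tcong_def by (simp add: algebra_simps)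

lemma tcong_map:
  assumes "tcong t n i x y" and f: "rlin (smul M) (carr M i) (smul M) (carr M j) f"
    and xy: "x \<in> carr M i" "y \<in> carr M i"
  shows "tcong t n j (f x) (f y)"
proof -
  obtain z where z: "z \<in> carr M i" "x - y = smul M (t ^ n) z" using assms(1) unfolding tcong_def by blast
  then have "f x - f y = smul M (t ^ n) (f z)"
    using rlin_diff[OF f rmod_carr xy] rlin_smul[OF f] by metis
  then show ?thesis unfolding tcong_def using z f by (auto simp: rlin_def)
qed

lemma rlin_smul_const: "rlin (smul M) (carr M i) (smul M) (carr M i) (smul M r)"
  unfolding rlin_def by (auto simp: smul_add smul_smul mult.commute)

lemma rlin_sgnact_const: "rlin (smul M) (carr M i) (smul M) (carr M i) (sgnact k)"
  unfolding rlin_def by (auto simp: smul_sgnact sgnact_add)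

lemma tcong_unique:
  assumes "tadic_complete t (smul M) (carr M i)" "x \<in> carr M i" "y \<in> carr M i"
    and "\<And>n. tcong t n i x y"
  shows "x = y"
proof -
  have "x - y = 0"
    using assms unfolding tadic_complete_def tcong_def by (meson diff_mem)
  then show ?thesis by simp
qed

end

context graded_act
begin

lemma rlin_act: "a \<in> carr B i \<Longrightarrow> k = i + j \<Longrightarrow>
    rlin (smul M) (carr M j) (smul M) (carr M k) (act M i j a)"
  unfolding rlin_def by (auto simp: act_add_right act_smul_right)

text \<open>The limit is chosen pointwise, with no linearity built into the choice. Linearity is
  recovered afterwards: both sides of each identity are congruent to the same expression in partial
  sums modulo every \<open>t ^ n\<close>, and the components are separated.\<close>

lemma hom_set_limit:
  assumes complete: "\<And>i. tadic_complete t (smul M) (carr M i)"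
    and \<gamma>: "\<And>n. \<gamma> n \<in> hom_set B M M p"
  obtains \<theta> where "\<theta> \<in> hom_set B M M p"
    and "\<And>i x n. x \<in> carr M i \<Longrightarrow>
      tcong t n (i + p) (\<theta> i x) (\<Sum>m<n. smul M (t ^ m) (\<gamma> m i x))"
proof -
  define S where "S = (\<lambda>n i x. \<Sum>m<n. smul M (t ^ m) (\<gamma> m i x))"
  have lin\<gamma>: "rlin (smul M) (carr M i) (smul M) (carr M (i + p)) (\<gamma> n i)" for n i
    using \<gamma> by (auto simp: hom_set_def)
  have Smem: "S n i x \<in> carr M (i + p)" if "x \<in> carr M i" for n i x
    unfolding S_def using that lin\<gamma> by (auto simp: rlin_def intro!: sum_mem)
  have "\<exists>s. \<forall>x. x \<in> carr M i \<longrightarrow> s x \<in> carr M (i + p) \<and> (\<forall>n. tcong t n (i + p) (s x) (S n i x))" for i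
  proof (rule choice, rule allI)
    fix x
    show "\<exists>s. x \<in> carr M i \<longrightarrow> s \<in> carr M (i + p) \<and> (\<forall>n. tcong t n (i + p) s (S n i x))"
    proof (cases "x \<in> carr M i")
      case True
      then have "\<forall>n. \<gamma> n i x \<in> carr M (i + p)" using lin\<gamma> by (auto simp: rlin_def)
      then have "\<exists>s\<in>carr M (i + p). \<forall>n. \<exists>z\<in>carr M (i + p). s - S n i x = smul M (t ^ n) z"
        using complete[of "i + p"] unfolding tadic_complete_def S_def by simp
      then show ?thesis unfolding tcong_def by auto
    qed simp
  qed
  then obtain \<theta> where \<theta>: "\<And>i x. x \<in> carr M i \<Longrightarrow> \<theta> i x \<in> carr M (i + p)"
    and lim: "\<And>i x n. x \<in> carr M i \<Longrightarrow> tcong t n (i + p) (\<theta> i x) (S n i x)"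
    by metis
  have "rlin (smul M) (carr M i) (smul M) (carr M (i + p)) (\<theta> i)" for i
    unfolding rlin_def
  proof (intro conjI ballI allI)
    fix x assume x: "x \<in> carr M i"
    show "\<theta> i x \<in> carr M (i + p)" using \<theta> x .
    show "\<theta> i (smul M r x) = smul M r (\<theta> i x)" for r
    proof (rule tcong_unique[OF complete[of "i + p"]])
      fix n
      have "S n i (smul M r x) = smul M r (S n i x)" unfolding S_def
        using rlin_mem[OF lin\<gamma> x] x
        by (auto simp: smul_sum[of _ _ "i + p"] rlin_smul[OF lin\<gamma>] smul_smul[of _ "i + p"] mult.commute intro!: sum.cong)
      then show "tcong t n (i + p) (\<theta> i (smul M r x)) (smul M r (\<theta> i x))"
        using tcong_trans[OF lim[of "smul M r x" i n]] x \<theta> Smem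
          tcong_sym[OF tcong_map[OF lim[OF x, of n] rlin_smul_const[of "i + p" r]]] by simp
    qed (use x \<theta> in auto)
    fix y assume y: "y \<in> carr M i"
    show "\<theta> i (x + y) = \<theta> i x + \<theta> i y"
    proof (rule tcong_unique[OF complete[of "i + p"]])
      fix n
      have "S n i (x + y) = S n i x + S n i y" unfolding S_def
        using rlin_mem[OF lin\<gamma>] x y
        by (auto simp: rlin_add[OF lin\<gamma>] smul_add[of _ "i + p"] sum.distrib)
      then show "tcong t n (i + p) (\<theta> i (x + y)) (\<theta> i x + \<theta> i y)"
        using tcong_trans[OF lim[of "x + y" i n]] x y
          tcong_sym[OF tcong_add[OF lim[OF x, of n] lim[OF y, of n]]] by simp
    qed (use x y \<theta> in auto)
  qed
  moreover have "\<theta> (i + j) (act M i j b x) = sgnact (p * i) (act M i (j + p) b (\<theta> j x))"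
    if b: "b \<in> carr B i" and x: "x \<in> carr M j" for i j b x
  proof (rule tcong_unique[OF complete[of "i + j + p"]])
    fix n
    have \<gamma>x: "\<gamma> m j x \<in> carr M (j + p)" for m using rlin_mem[OF lin\<gamma> x] .
    have "S n (i + j) (act M i j b x) = (\<Sum>m<n. smul M (t ^ m) (sgnact (p * i) (act M i (j + p) b (\<gamma> m j x))))"
      unfolding S_def using \<gamma> b x by (auto simp: hom_set_def intro!: sum.cong)
    also have "\<dots> = (\<Sum>m<n. sgnact (p * i) (act M i (j + p) b (smul M (t ^ m) (\<gamma> m j x))))"
      using b \<gamma>x by (auto simp: smul_sgnact[of _ "i + (j + p)"] act_smul_right intro!: sum.cong)
    also have "\<dots> = sgnact (p * i) (act M i (j + p) b (S n j x))"
      unfolding S_def using b \<gamma>x by (simp add: act_sum_right sgnact_def sum_negf)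
    finally have eq: "S n (i + j) (act M i j b x) = sgnact (p * i) (act M i (j + p) b (S n j x))" .
    have "tcong t n (i + j + p) (act M i (j + p) b (\<theta> j x)) (act M i (j + p) b (S n j x))"
      using tcong_map[OF lim[OF x, of n] rlin_act[OF b]] \<theta> Smem x by (simp add: algebra_simps)
    from tcong_sym[OF tcong_map[OF this rlin_sgnact_const[of "i + j + p" "p * i"]]]
    have "tcong t n (i + j + p) (S n (i + j) (act M i j b x)) (sgnact (p * i) (act M i (j + p) b (\<theta> j x)))"
      using b \<theta> Smem x unfolding eq by (auto simp: algebra_simps)
    then show "tcong t n (i + j + p) (\<theta> (i + j) (act M i j b x)) (sgnact (p * i) (act M i (j + p) b (\<theta> j x)))"
      using tcong_trans[OF lim[of "act M i j b x" "i + j" n]] b x by simp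
  qed (use b x \<theta> in auto)
  ultimately have "\<theta> \<in> hom_set B M M p" unfolding hom_set_def by blast
  then show thesis using that lim unfolding S_def by blast
qed

end

section \<open>Modules over the Koszul extension with a chosen splitting\<close>

text \<open>The Leibniz rule of a differential without square zero, since the component \<alpha> of
  a twisted differential satisfies \<alpha>\<alpha> = -t\<beta>. Two such maps differ by an element
  of \<open>hom_set A F F (- 1)\<close>, so adding t\<theta> to \<alpha> stays within this
  class.\<close>

definition graded_deriv :: "('r::comm_ring_1, 'a::ab_group_add) dga \<Rightarrow> ('r, 'a, 'm::ab_group_add) dgm
    \<Rightarrow> (int \<Rightarrow> 'm \<Rightarrow> 'm) \<Rightarrow> bool" where
  "graded_deriv A F \<alpha> \<longleftrightarrow> (\<forall>i. rlin (smul F) (carr F i) (smul F) (carr F (i - 1)) (\<alpha> i))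
     \<and> (\<forall>i j. \<forall>a\<in>carr A i. \<forall>x\<in>carr F j. \<alpha> (i + j) (act F i j a x)
          = act F (i - 1) j (dif A i a) x + sgnact i (act F i (j - 1) a (\<alpha> j x)))"

text \<open>The pair (x, y) stands for 1 \<otimes> x + X \<otimes> y, and the differential sends 1 \<otimes> x to
  1 \<otimes> \<alpha> x + X \<otimes> \<beta> x. Only the carriers, scalars and action of F are used, not its differential.\<close>
definition twist :: "'r::comm_ring_1 \<Rightarrow> ('r, 'a::ab_group_add, 'm::ab_group_add) dgm
    \<Rightarrow> (int \<Rightarrow> 'm \<Rightarrow> 'm) \<Rightarrow> (int \<Rightarrow> 'm \<Rightarrow> 'm) \<Rightarrow> ('r, 'a \<times> 'a, 'm \<times> 'm) dgm" where
  "twist t F \<alpha> \<beta> = (bchg t F)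
     \<lparr> dif := (\<lambda>i (x, y). (\<alpha> i x + smul F t y, \<beta> i x - \<alpha> (i - 1) y)) \<rparr>"

lemma carr_kos: "carr (kos A t) i = carr A i \<times> carr A (i - 1)"
  and smul_kos: "smul (kos A t) r (a, b) = (smul A r a, smul A r b)"
  and mul_kos: "mul (kos A t) i j (a, b) (c, d)
    = (mul A i j a c, mul A (i - 1) j b c + sgnact i (mul A i (j - 1) a d))"
  and one_kos: "one (kos A t) = (one A, 0)"
  and dif_kos: "dif (kos A t) i (a, b) = (dif A i a + smul A t b, - dif A (i - 1) b)"
  by (simp_all add: kos_def)

lemma carr_twist: "carr (twist t F \<alpha> \<beta>) i = carr F i \<times> carr F (i - 1)"
  and smul_twist: "smul (twist t F \<alpha> \<beta>) r (x, y) = (smul F r x, smul F r y)"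
  and dif_twist: "dif (twist t F \<alpha> \<beta>) i (x, y) = (\<alpha> i x + smul F t y, \<beta> i x - \<alpha> (i - 1) y)"
  and act_twist: "act (twist t F \<alpha> \<beta>) i j (a, b) (x, y)
    = (act F i j a x, act F (i - 1) j b x + sgnact i (act F i (j - 1) a y))"
  by (simp_all add: twist_def bchg_def)

lemmas twist_simps = carr_kos smul_kos mul_kos one_kos carr_twist smul_twist dif_twist act_twist

lemmas (in graded_rmod) smul_at = smul_add smul_diff smul_smul smul_sgnact smul_uminus

context graded_act
begin

lemma hom1D:
  assumes "\<theta> \<in> hom_set B M M (- 1)"
  shows "x \<in> carr M i \<Longrightarrow> k = i - 1 \<Longrightarrow> \<theta> i x \<in> carr M k"
    and "x \<in> carr M i \<Longrightarrow> y \<in> carr M i \<Longrightarrow> \<theta> i (x + y) = \<theta> i x + \<theta> i y"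
    and "x \<in> carr M i \<Longrightarrow> y \<in> carr M i \<Longrightarrow> \<theta> i (x - y) = \<theta> i x - \<theta> i y"
    and "x \<in> carr M i \<Longrightarrow> \<theta> i (smul M r x) = smul M r (\<theta> i x)"
    and "x \<in> carr M i \<Longrightarrow> \<theta> i (- x) = - \<theta> i x"
    and "\<theta> i 0 = 0"
    and "a \<in> carr B i \<Longrightarrow> x \<in> carr M j \<Longrightarrow> k = i + j \<Longrightarrow>
      \<theta> k (act M i j a x) = sgnact i (act M i (j - 1) a (\<theta> j x))"
proof -
  have lin: "rlin (smul M) (carr M i) (smul M) (carr M (i - 1)) (\<theta> i)" for i
    using assms by (simp add: hom_set_def)
  show "x \<in> carr M i \<Longrightarrow> k = i - 1 \<Longrightarrow> \<theta> i x \<in> carr M k"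
    and "x \<in> carr M i \<Longrightarrow> y \<in> carr M i \<Longrightarrow> \<theta> i (x + y) = \<theta> i x + \<theta> i y"
    and "x \<in> carr M i \<Longrightarrow> y \<in> carr M i \<Longrightarrow> \<theta> i (x - y) = \<theta> i x - \<theta> i y"
    and "x \<in> carr M i \<Longrightarrow> \<theta> i (smul M r x) = smul M r (\<theta> i x)"
    and "x \<in> carr M i \<Longrightarrow> \<theta> i (- x) = - \<theta> i x"
    and "\<theta> i 0 = 0"
    using rlin_diff[OF lin rmod_carr] rlin_uminus[OF lin rmod_carr] rlin_zero[OF lin zero_mem] lin
    by (auto simp: rlin_def)
  show "a \<in> carr B i \<Longrightarrow> x \<in> carr M j \<Longrightarrow> k = i + j \<Longrightarrow>
      \<theta> k (act M i j a x) = sgnact i (act M i (j - 1) a (\<theta> j x))"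
    using assms by (simp add: hom_set_def)
qed

lemma hom2D:
  assumes "\<delta> \<in> hom_set B M M (- 2)"
  shows "x \<in> carr M i \<Longrightarrow> k = i - 2 \<Longrightarrow> \<delta> i x \<in> carr M k"
    and "x \<in> carr M i \<Longrightarrow> y \<in> carr M i \<Longrightarrow> \<delta> i (x + y) = \<delta> i x + \<delta> i y"
    and "x \<in> carr M i \<Longrightarrow> y \<in> carr M i \<Longrightarrow> \<delta> i (x - y) = \<delta> i x - \<delta> i y"
    and "x \<in> carr M i \<Longrightarrow> \<delta> i (smul M r x) = smul M r (\<delta> i x)"
    and "x \<in> carr M i \<Longrightarrow> \<delta> i (- x) = - \<delta> i x"
    and "\<delta> i 0 = 0"
    and "a \<in> carr B i \<Longrightarrow> x \<in> carr M j \<Longrightarrow> k = i + j \<Longrightarrow>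
      \<delta> k (act M i j a x) = act M i (j - 2) a (\<delta> j x)"
proof -
  have lin: "rlin (smul M) (carr M i) (smul M) (carr M (i - 2)) (\<delta> i)" for i
    using assms by (simp add: hom_set_def)
  show "x \<in> carr M i \<Longrightarrow> k = i - 2 \<Longrightarrow> \<delta> i x \<in> carr M k"
    and "x \<in> carr M i \<Longrightarrow> y \<in> carr M i \<Longrightarrow> \<delta> i (x + y) = \<delta> i x + \<delta> i y"
    and "x \<in> carr M i \<Longrightarrow> y \<in> carr M i \<Longrightarrow> \<delta> i (x - y) = \<delta> i x - \<delta> i y"
    and "x \<in> carr M i \<Longrightarrow> \<delta> i (smul M r x) = smul M r (\<delta> i x)"
    and "x \<in> carr M i \<Longrightarrow> \<delta> i (- x) = - \<delta> i x"
    and "\<delta> i 0 = 0"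
    using rlin_diff[OF lin rmod_carr] rlin_uminus[OF lin rmod_carr] rlin_zero[OF lin zero_mem] lin
    by (auto simp: rlin_def)
  show "a \<in> carr B i \<Longrightarrow> x \<in> carr M j \<Longrightarrow> k = i + j \<Longrightarrow>
      \<delta> k (act M i j a x) = act M i (j - 2) a (\<delta> j x)"
    using assms by (simp add: hom_set_def)
qed

lemma hom1I:
  assumes "\<And>i x. x \<in> carr M i \<Longrightarrow> \<theta> i x \<in> carr M (i - 1)"
    and "\<And>i x y. x \<in> carr M i \<Longrightarrow> y \<in> carr M i \<Longrightarrow> \<theta> i (x + y) = \<theta> i x + \<theta> i y"
    and "\<And>i x r. x \<in> carr M i \<Longrightarrow> \<theta> i (smul M r x) = smul M r (\<theta> i x)"
    and "\<And>i j a x. a \<in> carr B i \<Longrightarrow> x \<in> carr M j \<Longrightarrow>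
      \<theta> (i + j) (act M i j a x) = sgnact i (act M i (j - 1) a (\<theta> j x))"
  shows "\<theta> \<in> hom_set B M M (- 1)"
  using assms by (simp add: hom_set_def rlin_def)

lemma hom2I:
  assumes "\<And>i x. x \<in> carr M i \<Longrightarrow> \<delta> i x \<in> carr M (i - 2)"
    and "\<And>i x y. x \<in> carr M i \<Longrightarrow> y \<in> carr M i \<Longrightarrow> \<delta> i (x + y) = \<delta> i x + \<delta> i y"
    and "\<And>i x r. x \<in> carr M i \<Longrightarrow> \<delta> i (smul M r x) = smul M r (\<delta> i x)"
    and "\<And>i j a x. a \<in> carr B i \<Longrightarrow> x \<in> carr M j \<Longrightarrow>
      \<delta> (i + j) (act M i j a x) = act M i (j - 2) a (\<delta> j x)"
  shows "\<delta> \<in> hom_set B M M (- 2)"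
  using assms by (simp add: hom_set_def rlin_def)

end

text \<open>\<open>square\<close> and \<open>commute\<close> are the two components of d d = 0 on
  \<open>(x, 0)\<close>: applying d to (\<alpha>x, \<beta>x) gives (\<alpha>\<alpha>x + t\<beta>x,
  \<beta>\<alpha>x - \<alpha>\<beta>x). On \<open>(0, y)\<close> the condition d d = 0 is again
  \<open>square\<close>.\<close>

locale koszul_module = graded_act F A
  for F :: "('r::comm_ring_1, 'a::ab_group_add, 'm::ab_group_add) dgm" and A :: "('r, 'a) dga" +
  fixes t :: 'r and \<alpha> \<beta> :: "int \<Rightarrow> 'm \<Rightarrow> 'm"
  assumes dga: "is_dga A"
    and deriv: "graded_deriv A F \<alpha>"
    and \<beta>: "\<beta> \<in> hom_set A F F (- 2)"
    and square: "x \<in> carr F i \<Longrightarrow> \<alpha> (i - 1) (\<alpha> i x) + smul F t (\<beta> i x) = 0"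
    and commute: "x \<in> carr F i \<Longrightarrow> \<alpha> (i - 2) (\<beta> i x) = \<beta> (i - 1) (\<alpha> i x)"
begin

lemma \<alpha>_lin: "rlin (smul F) (carr F i) (smul F) (carr F (i - 1)) (\<alpha> i)"
  using deriv by (simp add: graded_deriv_def)

lemma \<alpha>_mem: "x \<in> carr F i \<Longrightarrow> k = i - 1 \<Longrightarrow> \<alpha> i x \<in> carr F k"
  and \<alpha>_add: "x \<in> carr F i \<Longrightarrow> y \<in> carr F i \<Longrightarrow> \<alpha> i (x + y) = \<alpha> i x + \<alpha> i y"
  and \<alpha>_diff: "x \<in> carr F i \<Longrightarrow> y \<in> carr F i \<Longrightarrow> \<alpha> i (x - y) = \<alpha> i x - \<alpha> i y"
  and \<alpha>_smul: "x \<in> carr F i \<Longrightarrow> \<alpha> i (smul F r x) = smul F r (\<alpha> i x)"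
  and \<alpha>_uminus: "x \<in> carr F i \<Longrightarrow> \<alpha> i (- x) = - \<alpha> i x"
  and \<alpha>_zero: "\<alpha> i 0 = 0"
  using \<alpha>_lin[of i] rlin_diff[OF \<alpha>_lin rmod_carr] rlin_zero[OF \<alpha>_lin zero_mem]
    rlin_uminus[OF \<alpha>_lin rmod_carr] by (auto simp: rlin_def)

lemma \<alpha>_act: "a \<in> carr A i \<Longrightarrow> x \<in> carr F j \<Longrightarrow> k = i + j \<Longrightarrow>
    \<alpha> k (act F i j a x) = act F (i - 1) j (dif A i a) x + sgnact i (act F i (j - 1) a (\<alpha> j x))"
  using deriv by (simp add: graded_deriv_def)

lemmas \<beta>_simps = hom2D[OF \<beta>]

lemma difA_mem: "a \<in> carr A i \<Longrightarrow> k = i - 1 \<Longrightarrow> dif A i a \<in> carr A k"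
  using dga by (simp add: is_dga_def is_cx_def rlin_def)

lemma one_mem: "k = 0 \<Longrightarrow> one A \<in> carr A k"
  using dga by (simp add: is_dga_def)

text \<open>The components of the differential after conjugation by 1 - X\<theta>.\<close>
definition \<alpha>' :: "(int \<Rightarrow> 'm \<Rightarrow> 'm) \<Rightarrow> int \<Rightarrow> 'm \<Rightarrow> 'm" where
  "\<alpha>' \<theta> = (\<lambda>i x. \<alpha> i x + smul F t (\<theta> i x))"

definition \<beta>' :: "(int \<Rightarrow> 'm \<Rightarrow> 'm) \<Rightarrow> int \<Rightarrow> 'm \<Rightarrow> 'm" where
  "\<beta>' \<theta> = (\<lambda>i x. \<beta> i x - \<alpha> (i - 1) (\<theta> i x) - \<theta> (i - 1) (\<alpha> i x) - smul F t (\<theta> (i - 1) (\<theta> i x)))"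

lemmas \<alpha>_simps = \<alpha>_mem \<alpha>_add \<alpha>_diff \<alpha>_smul \<alpha>_uminus \<alpha>_zero

lemma koszul_module_change:
  assumes \<theta>: "\<theta> \<in> hom_set A F F (- 1)"
  shows "koszul_module F A t (\<alpha>' \<theta>) (\<beta>' \<theta>)"
proof
  note \<theta>_simps = hom1D[OF \<theta>]
  show "graded_deriv A F (\<alpha>' \<theta>)"
    unfolding graded_deriv_def rlin_def \<alpha>'_def
  proof (intro conjI allI ballI, goal_cases)
    case (1 i x) then show ?case by (simp add: \<alpha>_simps \<theta>_simps)
  next
    case (2 i x y) then show ?case
      by (simp add: \<alpha>_simps \<theta>_simps smul_at[where i = "i - 1"])
  next
    case (3 i r x) then show ?case
      by (simp add: \<alpha>_simps \<theta>_simps smul_at[where i = "i - 1"] mult.commute)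
  next
    case (4 i j a x) then show ?case
      by (simp add: \<alpha>_act \<alpha>_simps \<theta>_simps smul_at[where i = "i + (j - 1)"] act_add_right
        act_smul_right difA_mem sgnact_add)
  qed
  show "\<beta>' \<theta> \<in> hom_set A F F (- 2)"
    unfolding \<beta>'_def
  proof (rule hom2I, goal_cases)
    case (1 i x) then show ?case by (simp add: \<alpha>_simps \<beta>_simps \<theta>_simps)
  next
    case (2 i x y) then show ?case
      by (simp add: \<alpha>_simps \<beta>_simps \<theta>_simps smul_at[where i = "i - 2"])
  next
    case (3 i x r) then show ?case
      by (simp add: \<alpha>_simps \<beta>_simps \<theta>_simps smul_at[where i = "i - 2"] mult.commute)
  next
    \<comment> \<open>The terms containing \<open>dif A i a\<close> cancel: they carry the sign
      (-1)^i in \<alpha>\<theta> and (-1)^(i-1) in \<theta>\<alpha>.\<close>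
    case (4 i j a x) then show ?case
      by (cases "even i") (simp_all add: \<alpha>_act \<alpha>_simps \<beta>_simps \<theta>_simps
        smul_at[where i = "i + (j - 2)"] smul_at[where i = "i + j - 2"] act_diff_right act_smul_right difA_mem)
  qed
  show "\<alpha>' \<theta> (i - 1) (\<alpha>' \<theta> i x) + smul F t (\<beta>' \<theta> i x) = 0" if x: "x \<in> carr F i" for x i
    using square[OF x] x
    by (simp add: \<alpha>'_def \<beta>'_def \<alpha>_simps \<beta>_simps \<theta>_simps smul_at[where i = "i - 2"] algebra_simps)
  show "\<alpha>' \<theta> (i - 2) (\<beta>' \<theta> i x) = \<beta>' \<theta> (i - 1) (\<alpha>' \<theta> i x)" if x: "x \<in> carr F i" for x i
  proof -
    \<comment> \<open>Besides \<alpha>\<beta> = \<beta>\<alpha>, the two sides differ only in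
      -\<alpha>\<alpha>\<theta> + t\<theta>\<beta> against -\<theta>\<alpha>\<alpha> +
      t\<beta>\<theta>. Both become t(\<beta>\<theta> + \<theta>\<beta>) once \<alpha>\<alpha> is
      replaced by -t\<beta>, at x and at \<theta>x.\<close>
    have "\<alpha> (i - 1) (\<alpha> i x) = - smul F t (\<beta> i x)"
      using square[OF x] by (simp add: eq_neg_iff_add_eq_0)
    moreover have "\<alpha> (i - 2) (\<alpha> (i - 1) (\<theta> i x)) = - smul F t (\<beta> (i - 1) (\<theta> i x))"
      using square[of "\<theta> i x" "i - 1"] x \<theta>_simps(1) by (simp add: eq_neg_iff_add_eq_0)
    ultimately show ?thesis
      using commute[OF x] x
      by (simp add: \<alpha>'_def \<beta>'_def \<alpha>_simps \<beta>_simps \<theta>_simps smul_at[where i = "i - 2"]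
          smul_at[where i = "i - 3"] algebra_simps)
  qed
qed (rule dga)

text \<open>The preimage of (x, 0) under the isomorphism is (x, \<theta>x), with differential
  (\<alpha>x + t\<theta>x, \<beta>x - \<alpha>\<theta>x). Mapping this forward subtracts \<theta> of
  the first entry from the second, which is the origin of the formulas for \<open>\<alpha>'\<close>
  and \<open>\<beta>'\<close>. The sign of \<theta> against scalars equals that of X, so the map is
  linear over the Koszul extension.\<close>

lemma dg_iso_change:
  assumes \<theta>: "\<theta> \<in> hom_set A F F (- 1)"
  shows "dg_iso (kos A t) (twist t F \<alpha> \<beta>) (twist t F (\<alpha>' \<theta>) (\<beta>' \<theta>))"
proof (rule dg_isoI)
  note \<theta>_simps = hom1D[OF \<theta>]
  let ?\<phi> = "\<lambda>i (x, y). (x, y - \<theta> i x)"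
  show "dg_hom (kos A t) (twist t F \<alpha> \<beta>) (twist t F (\<alpha>' \<theta>) (\<beta>' \<theta>)) ?\<phi>"
    unfolding dg_hom_def rlin_def
  proof (intro conjI allI ballI, goal_cases)
    case (1 i u) then show ?case by (auto simp: twist_simps \<theta>_simps)
  next
    case (2 i u v) then show ?case by (auto simp: twist_simps \<theta>_simps)
  next
    case (3 i r u) then show ?case by (auto simp: twist_simps \<theta>_simps smul_at[where i = "i - 1"])
  next
    case (4 i u) then show ?case
      by (auto simp: twist_simps \<alpha>'_def \<beta>'_def \<alpha>_simps \<beta>_simps \<theta>_simps
        smul_at[where i = "i - 1"] smul_at[where i = "i - 2"] algebra_simps)
  next
    case (5 i j b u) then show ?case
      by (auto simp: twist_simps \<theta>_simps act_diff_right sgnact_diff)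
  qed
  show "bij_betw (?\<phi> i) (carr (twist t F \<alpha> \<beta>) i) (carr (twist t F (\<alpha>' \<theta>) (\<beta>' \<theta>)) i)" for i
    by (rule bij_betw_byWitness[where f' = "\<lambda>(x, y). (x, y + \<theta> i x)"])
      (auto simp: twist_simps \<theta>_simps)
qed

text \<open>As -2 is even, the extension f of \<delta> to pairs carries no signs, and commuting with
  \<alpha> and \<beta> makes it a cycle. The two equations obtained are the components at
  \<open>(x, 0)\<close> of d g + g d = f, where g sends (x, 0) to (\<gamma>x, \<epsilon>x).\<close>

lemma ext_step:
  assumes ext: "ext_zero (kos A t) (twist t F \<alpha> \<beta>) (twist t F \<alpha> \<beta>) 2"
    and \<delta>: "\<delta> \<in> hom_set A F F (- 2)"
    and \<alpha>\<delta>: "\<And>i x. x \<in> carr F i \<Longrightarrow> \<alpha> (i - 2) (\<delta> i x) = \<delta> (i - 1) (\<alpha> i x)"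
    and \<beta>\<delta>: "\<And>i x. x \<in> carr F i \<Longrightarrow> \<beta> (i - 2) (\<delta> i x) = \<delta> (i - 2) (\<beta> i x)"
  obtains \<gamma> \<epsilon> where "\<gamma> \<in> hom_set A F F (- 1)" "\<epsilon> \<in> hom_set A F F (- 2)"
    and "\<And>i x. x \<in> carr F i \<Longrightarrow>
      \<delta> i x = \<alpha> (i - 1) (\<gamma> i x) + \<gamma> (i - 1) (\<alpha> i x) + smul F t (\<epsilon> i x)"
    and "\<And>i x. x \<in> carr F i \<Longrightarrow>
      \<alpha> (i - 2) (\<epsilon> i x) - \<epsilon> (i - 1) (\<alpha> i x) = \<beta> (i - 1) (\<gamma> i x) - \<gamma> (i - 2) (\<beta> i x)"
proof -
  note \<delta>_simps = hom2D[OF \<delta>]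
  let ?P = "twist t F \<alpha> \<beta>" and ?f = "\<lambda>i (x, y). (\<delta> i x, \<delta> (i - 1) y)"
  have f: "?f \<in> hom_set (kos A t) ?P ?P (- 2)"
    unfolding hom_set_def rlin_def
  proof (intro CollectI conjI allI ballI, goal_cases)
    case (1 i u) then show ?case by (auto simp: twist_simps \<delta>_simps)
  next
    case (2 i u v) then show ?case by (auto simp: twist_simps \<delta>_simps)
  next
    case (3 i r u) then show ?case by (auto simp: twist_simps \<delta>_simps)
  next
    case (4 i j b u) then show ?case
      by (cases "even i") (auto simp: twist_simps \<delta>_simps)
  qed
  have cyc: "hom_d ?P ?P (- 2) ?f i u = 0" if u: "u \<in> carr ?P i" for i u
  proof -
    obtain x y where u: "u = (x, y)" "x \<in> carr F i" "y \<in> carr F (i - 1)"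
      using u by (auto simp: twist_simps)
    then show ?thesis
      using \<alpha>\<delta>[of x i] \<beta>\<delta>[of x i] \<alpha>\<delta>[of y "i - 1"]
      by (simp add: hom_d_def twist_simps \<delta>_simps \<alpha>_simps \<beta>_simps zero_prod_def)
  qed
  obtain g where g: "g \<in> hom_set (kos A t) ?P ?P (- 1)"
    and gf: "\<And>i u. u \<in> carr ?P i \<Longrightarrow> hom_d ?P ?P (- 1) g i u = ?f i u"
    using ext[unfolded ext_zero_def, rule_format, OF f cyc] by auto
  have g_mem: "g i u \<in> carr F (i - 1) \<times> carr F (i - 2)"
    and g_add: "v \<in> carr ?P i \<Longrightarrow> g i (u + v) = g i u + g i v"
    and g_smul: "g i (smul ?P r u) = smul ?P r (g i u)" if "u \<in> carr ?P i" for i u v r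
    using g that unfolding hom_set_def rlin_def by (auto simp: carr_twist)
  have g_act: "g (i + j) (act ?P i j b u) = sgnact i (act ?P i (j - 1) b (g j u))"
    if "b \<in> carr (kos A t) i" "u \<in> carr ?P j" for i j b u
    using g that unfolding hom_set_def by simp
  define \<gamma> where "\<gamma> = (\<lambda>i x. fst (g i (x, 0)))"
  define \<epsilon> where "\<epsilon> = (\<lambda>i x. snd (g i (x, 0)))"
  have gx: "g i (x, 0) = (\<gamma> i x, \<epsilon> i x)" for i x by (simp add: \<gamma>_def \<epsilon>_def)
  have g0_mem: "\<gamma> i x \<in> carr F (i - 1)" "\<epsilon> i x \<in> carr F (i - 2)" if "x \<in> carr F i" for i x
    using g_mem[of "(x, 0)" i] that by (auto simp: carr_twist gx)
  have g0_add: "\<gamma> i (x + y) = \<gamma> i x + \<gamma> i y" "\<epsilon> i (x + y) = \<epsilon> i x + \<epsilon> i y"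
    if "x \<in> carr F i" "y \<in> carr F i" for i x y
    using g_add[of "(x, 0)" i "(y, 0)"] that by (auto simp: carr_twist gx)
  have g0_smul: "\<gamma> i (smul F r x) = smul F r (\<gamma> i x)" "\<epsilon> i (smul F r x) = smul F r (\<epsilon> i x)"
    if "x \<in> carr F i" for i x r
    using g_smul[of "(x, 0)" i r] that by (auto simp: twist_simps gx)
  have g0_act: "\<gamma> (i + j) (act F i j a x) = sgnact i (act F i (j - 1) a (\<gamma> j x))"
    "\<epsilon> (i + j) (act F i j a x) = act F i (j - 2) a (\<epsilon> j x)"
    if a: "a \<in> carr A i" and x: "x \<in> carr F j" for i j a x
  proof -
    have "g (i + j) (act ?P i j (a, 0) (x, 0)) = sgnact i (act ?P i (j - 1) (a, 0) (g j (x, 0)))"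
      using g_act[of "(a, 0)" i "(x, 0)" j] a x by (simp add: twist_simps)
    then show "\<gamma> (i + j) (act F i j a x) = sgnact i (act F i (j - 1) a (\<gamma> j x))"
      "\<epsilon> (i + j) (act F i j a x) = act F i (j - 2) a (\<epsilon> j x)"
      using a x g0_mem[OF x] by (auto simp: twist_simps gx sgnact_Pair)
  qed
  have \<gamma>: "\<gamma> \<in> hom_set A F F (- 1)"
    using g0_mem g0_add g0_smul g0_act by (intro hom1I) auto
  have \<epsilon>: "\<epsilon> \<in> hom_set A F F (- 2)"
    using g0_mem g0_add g0_smul g0_act by (intro hom2I) auto
  \<comment> \<open>The element (0, y) is the product of the Koszul generator (0, 1) and (y, 0).\<close>
  have g0y: "g i (0, y) = (0, - \<gamma> (i - 1) y)" if y: "y \<in> carr F (i - 1)" for i y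
  proof -
    have "act ?P 1 (i - 1) (0, one A) (y, 0) = (0, y)"
      using y by (simp add: twist_simps one_mem act_one)
    \<comment> \<open>The sign arises from moving g, of degree -1, past X, of degree 1. The
      \<epsilon> part disappears because it would contain X twice.\<close>
    then have "g i (0, y) = sgnact 1 (act ?P 1 (i - 1 - 1) (0, one A) (g (i - 1) (y, 0)))"
      using g_act[of "(0, one A)" 1 "(y, 0)" "i - 1"] y by (simp add: twist_simps one_mem)
    then show ?thesis
      using y g0_mem[OF y] by (simp add: gx twist_simps one_mem act_one)
  qed
  have key: "\<delta> i x = \<alpha> (i - 1) (\<gamma> i x) + smul F t (\<epsilon> i x) + \<gamma> (i - 1) (\<alpha> i x)"
    "0 = \<beta> (i - 1) (\<gamma> i x) - \<alpha> (i - 2) (\<epsilon> i x) + (\<epsilon> (i - 1) (\<alpha> i x) - \<gamma> (i - 2) (\<beta> i x))"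
    if x: "x \<in> carr F i" for i x
  proof -
    have "g (i - 1) (\<alpha> i x, \<beta> i x) = g (i - 1) (\<alpha> i x, 0) + g (i - 1) (0, \<beta> i x)"
      using g_add[of "(\<alpha> i x, 0)" "i - 1" "(0, \<beta> i x)"] x
      by (simp add: twist_simps \<alpha>_simps \<beta>_simps)
    also have "\<dots> = (\<gamma> (i - 1) (\<alpha> i x), \<epsilon> (i - 1) (\<alpha> i x) - \<gamma> (i - 2) (\<beta> i x))"
      using g0y[of "\<beta> i x" "i - 1"] x by (simp add: gx \<beta>_simps)
    finally have "hom_d ?P ?P (- 1) g i (x, 0) = (\<alpha> (i - 1) (\<gamma> i x) + smul F t (\<epsilon> i x),
        \<beta> (i - 1) (\<gamma> i x) - \<alpha> (i - 2) (\<epsilon> i x))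
        + (\<gamma> (i - 1) (\<alpha> i x), \<epsilon> (i - 1) (\<alpha> i x) - \<gamma> (i - 2) (\<beta> i x))"
      using x by (simp add: hom_d_def gx twist_simps \<alpha>_simps \<beta>_simps)
    then show "\<delta> i x = \<alpha> (i - 1) (\<gamma> i x) + smul F t (\<epsilon> i x) + \<gamma> (i - 1) (\<alpha> i x)"
      "0 = \<beta> (i - 1) (\<gamma> i x) - \<alpha> (i - 2) (\<epsilon> i x) + (\<epsilon> (i - 1) (\<alpha> i x) - \<gamma> (i - 2) (\<beta> i x))"
      using gf[of "(x, 0)" i] x by (simp_all add: twist_simps \<delta>_simps)
  qed
  show thesis
  proof (rule that[OF \<gamma> \<epsilon>])
    show "\<delta> i x = \<alpha> (i - 1) (\<gamma> i x) + \<gamma> (i - 1) (\<alpha> i x) + smul F t (\<epsilon> i x)"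
      if x: "x \<in> carr F i" for i x
      using key(1)[OF x] by (simp add: algebra_simps)
    show "\<alpha> (i - 2) (\<epsilon> i x) - \<epsilon> (i - 1) (\<alpha> i x) = \<beta> (i - 1) (\<gamma> i x) - \<gamma> (i - 2) (\<beta> i x)"
      if x: "x \<in> carr F i" for i x
      using key(2)[OF x] by (simp add: algebra_simps)
  qed
qed


lemma rmod_twist: "rmod (smul (twist t F \<alpha> \<beta>)) (carr (twist t F \<alpha> \<beta>) i)"
  by (auto simp: rmod_def twist_simps zero_prod_def smul_add add_smul smul_smul smul_one)

lemma dif_twist_mem:
  "u \<in> carr (twist t F \<alpha> \<beta>) i \<Longrightarrow> dif (twist t F \<alpha> \<beta>) i u \<in> carr (twist t F \<alpha> \<beta>) (i - 1)"
  by (auto simp: twist_simps \<alpha>_simps \<beta>_simps)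

lemma act_twist_mem:
  "b \<in> carr (kos A t) i \<Longrightarrow> u \<in> carr (twist t F \<alpha> \<beta>) j \<Longrightarrow>
    act (twist t F \<alpha> \<beta>) i j b u \<in> carr (twist t F \<alpha> \<beta>) (i + j)"
  by (auto simp: twist_simps)

text \<open>The first equation of \<open>ext_step\<close> collapses the linear part of the
  conjugated \<beta>: t^n (\<delta> - \<alpha>\<gamma> - \<gamma>\<alpha>) = t^(n+1) \<epsilon>. As
  t cannot be cancelled, commutation of \<open>\<delta>'\<close> with the new \<alpha> cannot be
  read off from that of the new \<beta>; the second equation supplies it.\<close>

lemma improve:
  assumes ext: "ext_zero (kos A t) (twist t F \<alpha> \<beta>) (twist t F \<alpha> \<beta>) 2"
    and \<delta>: "\<delta> \<in> hom_set A F F (- 2)"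
    and \<beta>\<delta>: "\<And>i x. x \<in> carr F i \<Longrightarrow> \<beta> i x = smul F (t ^ n) (\<delta> i x)"
    and \<alpha>\<delta>: "\<And>i x. x \<in> carr F i \<Longrightarrow> \<alpha> (i - 2) (\<delta> i x) = \<delta> (i - 1) (\<alpha> i x)"
  obtains \<gamma> \<delta>' where "\<gamma> \<in> hom_set A F F (- 1)" "\<delta>' \<in> hom_set A F F (- 2)"
    and "\<And>i x. x \<in> carr F i \<Longrightarrow>
      \<beta>' (\<lambda>i x. smul F (t ^ n) (\<gamma> i x)) i x = smul F (t ^ Suc n) (\<delta>' i x)"
    and "\<And>i x. x \<in> carr F i \<Longrightarrow> \<alpha>' (\<lambda>i x. smul F (t ^ n) (\<gamma> i x)) (i - 2) (\<delta>' i x)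
      = \<delta>' (i - 1) (\<alpha>' (\<lambda>i x. smul F (t ^ n) (\<gamma> i x)) i x)"
proof -
  note \<delta>_simps = hom2D[OF \<delta>]
  \<comment> \<open>Both sides are t^n \<delta>\<delta>x.\<close>
  have "\<beta> (i - 2) (\<delta> i x) = \<delta> (i - 2) (\<beta> i x)" if "x \<in> carr F i" for i x
    using that \<beta>\<delta>[of "\<delta> i x" "i - 2"] \<beta>\<delta>[of x i] \<delta>_simps by simp
  then obtain \<gamma> \<epsilon> where \<gamma>: "\<gamma> \<in> hom_set A F F (- 1)" and \<epsilon>: "\<epsilon> \<in> hom_set A F F (- 2)"
    and eq1: "\<And>i x. x \<in> carr F i \<Longrightarrow>
      \<delta> i x = \<alpha> (i - 1) (\<gamma> i x) + \<gamma> (i - 1) (\<alpha> i x) + smul F t (\<epsilon> i x)"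
    and eq2: "\<And>i x. x \<in> carr F i \<Longrightarrow>
      \<alpha> (i - 2) (\<epsilon> i x) - \<epsilon> (i - 1) (\<alpha> i x) = \<beta> (i - 1) (\<gamma> i x) - \<gamma> (i - 2) (\<beta> i x)"
    using ext_step[OF ext \<delta> \<alpha>\<delta>] by blast
  note \<gamma>_simps = hom1D[OF \<gamma>] and \<epsilon>_simps = hom2D[OF \<epsilon>]
  \<comment> \<open>The second term absorbs the quadratic part t\<theta>\<theta> = t^(2n+1)
    \<gamma>\<gamma> of the conjugation by \<theta> = t^n \<gamma>.\<close>
  define \<delta>' where "\<delta>' = (\<lambda>i x. \<epsilon> i x - smul F (t ^ n) (\<gamma> (i - 1) (\<gamma> i x)))"
  show thesis
  proof (rule that[OF \<gamma>])
    show "\<delta>' \<in> hom_set A F F (- 2)"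
      unfolding \<delta>'_def
    proof (rule hom2I, goal_cases)
      case (1 i x) then show ?case by (simp add: \<epsilon>_simps \<gamma>_simps)
    next
      case (2 i x y) then show ?case by (simp add: \<epsilon>_simps \<gamma>_simps smul_at[where i = "i - 2"])
    next
      case (3 i x r) then show ?case
        by (simp add: \<epsilon>_simps \<gamma>_simps smul_at[where i = "i - 2"] mult.commute)
    next
      case (4 i j a x) then show ?case
        by (cases "even i") (simp_all add: \<epsilon>_simps \<gamma>_simps smul_at[where i = "i + (j - 2)"]
          act_diff_right act_smul_right)
    qed
    show "\<beta>' (\<lambda>i x. smul F (t ^ n) (\<gamma> i x)) i x = smul F (t ^ Suc n) (\<delta>' i x)"
      if x: "x \<in> carr F i" for i x
      using x by (simp add: \<beta>'_def \<delta>'_def \<beta>\<delta> eq1 \<alpha>_simps \<gamma>_simps \<epsilon>_simps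
          smul_at[where i = "i - 1"] smul_at[where i = "i - 2"] ac_simps)
    show "\<alpha>' (\<lambda>i x. smul F (t ^ n) (\<gamma> i x)) (i - 2) (\<delta>' i x)
      = \<delta>' (i - 1) (\<alpha>' (\<lambda>i x. smul F (t ^ n) (\<gamma> i x)) i x)" if x: "x \<in> carr F i" for i x
    proof -
      \<comment> \<open>The three identities move \<alpha> to the right past \<gamma> and
        \<epsilon>: the first equation at x and at \<gamma>x, and the second with \<beta> = t^n
        \<delta>. After substitution all terms containing \<delta> cancel.\<close>
      have 1: "\<alpha> (i - 1) (\<gamma> i x) = \<delta> i x - \<gamma> (i - 1) (\<alpha> i x) - smul F t (\<epsilon> i x)"
        using eq1[OF x] by simp
      have 2: "\<alpha> (i - 2) (\<gamma> (i - 1) (\<gamma> i x)) = \<delta> (i - 1) (\<gamma> i x) - \<gamma> (i - 2) (\<alpha> (i - 1) (\<gamma> i x))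
          - smul F t (\<epsilon> (i - 1) (\<gamma> i x))"
        using eq1[of "\<gamma> i x" "i - 1"] x by (simp add: \<gamma>_simps)
      have 3: "\<alpha> (i - 2) (\<epsilon> i x) = \<epsilon> (i - 1) (\<alpha> i x)
          + smul F (t ^ n) (\<delta> (i - 1) (\<gamma> i x)) - smul F (t ^ n) (\<gamma> (i - 2) (\<delta> i x))"
        using eq2[OF x] x \<beta>\<delta>[OF x] \<beta>\<delta>[of "\<gamma> i x" "i - 1"] by (simp add: \<gamma>_simps \<delta>_simps algebra_simps)
      show ?thesis
        using x by (simp add: \<alpha>'_def \<delta>'_def 1 2 3 \<alpha>_simps \<gamma>_simps \<epsilon>_simps \<delta>_simps
          smul_at[where i = "i - 1"] smul_at[where i = "i - 2"] smul_at[where i = "i - 3"] algebra_simps)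
    qed
  qed
qed

text \<open>(1 - X\<eta>)(1 - X\<theta>) = 1 - X(\<theta> + \<eta>), since the cross term contains X
  twice. Hence every stage of the iteration can be recorded by one \<theta> relative to the original
  \<alpha> and \<beta>.\<close>

lemma change_change:
  assumes \<theta>: "\<theta> \<in> hom_set A F F (- 1)" and \<eta>: "\<eta> \<in> hom_set A F F (- 1)" and x: "x \<in> carr F i"
  shows "\<alpha>' (\<lambda>i x. \<theta> i x + \<eta> i x) i x = koszul_module.\<alpha>' F t (\<alpha>' \<theta>) \<eta> i x"
    and "\<beta>' (\<lambda>i x. \<theta> i x + \<eta> i x) i x = koszul_module.\<beta>' F t (\<alpha>' \<theta>) (\<beta>' \<theta>) \<eta> i x"
proof -
  interpret K: koszul_module F A t "\<alpha>' \<theta>" "\<beta>' \<theta>" by (rule koszul_module_change[OF \<theta>])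
  show "\<alpha>' (\<lambda>i x. \<theta> i x + \<eta> i x) i x = K.\<alpha>' \<eta> i x"
    unfolding K.\<alpha>'_def using x
    by (simp add: \<alpha>'_def hom1D[OF \<theta>] hom1D[OF \<eta>] smul_at[where i = "i - 1"])
  show "\<beta>' (\<lambda>i x. \<theta> i x + \<eta> i x) i x = K.\<beta>' \<eta> i x"
    unfolding K.\<beta>'_def using x
    by (simp add: \<beta>'_def \<alpha>'_def hom1D[OF \<theta>] hom1D[OF \<eta>] \<alpha>_simps
        smul_at[where i = "i - 1"] smul_at[where i = "i - 2"] algebra_simps)
qed

section \<open>Iterated conjugation and its limit\<close>

lemma smul_hom1:
  assumes "\<gamma> \<in> hom_set A F F (- 1)" shows "(\<lambda>i x. smul F r (\<gamma> i x)) \<in> hom_set A F F (- 1)"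
proof (rule hom1I, goal_cases)
  case (1 i x) then show ?case by (simp add: hom1D[OF assms])
next
  case (2 i x y) then show ?case by (simp add: hom1D[OF assms] smul_at[where i = "i - 1"])
next
  case (3 i x r) then show ?case
    by (simp add: hom1D[OF assms] smul_at[where i = "i - 1"] mult.commute)
next
  case (4 i j a x) then show ?case
    by (simp add: hom1D[OF assms] smul_at[where i = "i + (j - 1)"] act_smul_right)
qed

lemma add_hom1:
  assumes "\<gamma> \<in> hom_set A F F (- 1)" "\<eta> \<in> hom_set A F F (- 1)"
  shows "(\<lambda>i x. \<gamma> i x + \<eta> i x) \<in> hom_set A F F (- 1)"
proof (rule hom1I, goal_cases)
  case (3 i x r) then show ?case
    by (simp add: hom1D[OF assms(1)] hom1D[OF assms(2)] smul_at[where i = "i - 1"])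
qed (simp_all add: hom1D[OF assms(1)] hom1D[OF assms(2)] act_add_right sgnact_add algebra_simps)

text \<open>\<delta> is kept as an explicit witness with its own commutation clause, because neither
  can be recovered from \<open>\<beta>' \<theta>\<close> when t is a zero divisor.\<close>

definition approx :: "nat \<Rightarrow> (int \<Rightarrow> 'm \<Rightarrow> 'm) \<Rightarrow> (int \<Rightarrow> 'm \<Rightarrow> 'm) \<Rightarrow> bool" where
  "approx n \<theta> \<delta> \<longleftrightarrow> \<theta> \<in> hom_set A F F (- 1) \<and> \<delta> \<in> hom_set A F F (- 2)
    \<and> (\<forall>i. \<forall>x\<in>carr F i. \<beta>' \<theta> i x = smul F (t ^ n) (\<delta> i x))
    \<and> (\<forall>i. \<forall>x\<in>carr F i. \<alpha>' \<theta> (i - 2) (\<delta> i x) = \<delta> (i - 1) (\<alpha>' \<theta> i x))"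

lemma approx_0: "approx 0 (\<lambda>_ _. 0) \<beta>"
proof -
  have "(\<lambda>_ _. 0) \<in> hom_set A F F (- 1)" by (rule hom1I) simp_all
  then show ?thesis
    using commute \<beta>
    by (simp add: approx_def \<alpha>'_def \<beta>'_def \<alpha>_zero smul_one[OF hom2D(1)[OF \<beta> _ refl]])
qed

text \<open>The pair of \<open>\<alpha>' \<theta>\<close> and \<open>\<beta>' \<theta>\<close> is
  treated as a twisted differential in its own right: the vanishing of Ext reaches it through the
  conjugating isomorphism, \<open>improve\<close> is applied there, and \<open>change_change\<close>
  expresses the outcome through the original pair.\<close>

lemma approx_Suc:
  assumes ext: "ext_zero (kos A t) (twist t F \<alpha> \<beta>) (twist t F \<alpha> \<beta>) 2"
    and "approx n \<theta> \<delta>"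
  obtains \<gamma> \<delta>' where "\<gamma> \<in> hom_set A F F (- 1)"
    and "approx (Suc n) (\<lambda>i x. \<theta> i x + smul F (t ^ n) (\<gamma> i x)) \<delta>'"
proof -
  have \<theta>: "\<theta> \<in> hom_set A F F (- 1)" and \<delta>: "\<delta> \<in> hom_set A F F (- 2)"
    and \<beta>\<delta>: "\<And>i x. x \<in> carr F i \<Longrightarrow> \<beta>' \<theta> i x = smul F (t ^ n) (\<delta> i x)"
    and \<alpha>\<delta>: "\<And>i x. x \<in> carr F i \<Longrightarrow> \<alpha>' \<theta> (i - 2) (\<delta> i x) = \<delta> (i - 1) (\<alpha>' \<theta> i x)"
    using assms(2) by (auto simp: approx_def)
  interpret K: koszul_module F A t "\<alpha>' \<theta>" "\<beta>' \<theta>" by (rule koszul_module_change[OF \<theta>])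
  have "ext_zero (kos A t) (twist t F (\<alpha>' \<theta>) (\<beta>' \<theta>)) (twist t F (\<alpha>' \<theta>) (\<beta>' \<theta>)) 2"
    by (rule ext_zero_dg_iso[OF dg_iso_change[OF \<theta>] ext rmod_twist dif_twist_mem act_twist_mem
      K.rmod_twist K.dif_twist_mem K.act_twist_mem])
  from K.improve[OF this \<delta> \<beta>\<delta> \<alpha>\<delta>] obtain \<gamma> \<delta>' where
    \<gamma>: "\<gamma> \<in> hom_set A F F (- 1)" and \<delta>': "\<delta>' \<in> hom_set A F F (- 2)"
    and eq: "\<And>i x. x \<in> carr F i \<Longrightarrow>
      K.\<beta>' (\<lambda>i x. smul F (t ^ n) (\<gamma> i x)) i x = smul F (t ^ Suc n) (\<delta>' i x)"
      "\<And>i x. x \<in> carr F i \<Longrightarrow> K.\<alpha>' (\<lambda>i x. smul F (t ^ n) (\<gamma> i x)) (i - 2) (\<delta>' i x)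
      = \<delta>' (i - 1) (K.\<alpha>' (\<lambda>i x. smul F (t ^ n) (\<gamma> i x)) i x)"
    by metis
  note \<eta> = smul_hom1[OF \<gamma>, of "t ^ n"]
  have "approx (Suc n) (\<lambda>i x. \<theta> i x + smul F (t ^ n) (\<gamma> i x)) \<delta>'"
    unfolding approx_def using \<delta>' add_hom1[OF \<theta> \<eta>]
    by (simp add: change_change[OF \<theta> \<eta>] eq hom2D(1)[OF \<delta>'] del: power_Suc)
  with \<gamma> show thesis by (rule that)
qed

text \<open>\<open>\<beta>'\<close> is built from \<theta> by operations compatible with
  congruences, so its value at the limit is congruent modulo t^n to its value at the n-th partial
  sum, a multiple of t^n. Separatedness then gives 0.\<close>

lemma exists_change:
  assumes ext: "ext_zero (kos A t) (twist t F \<alpha> \<beta>) (twist t F \<alpha> \<beta>) 2"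
    and complete: "\<And>i. tadic_complete t (smul F) (carr F i)"
  obtains \<theta> where "\<theta> \<in> hom_set A F F (- 1)" "\<And>i x. x \<in> carr F i \<Longrightarrow> \<beta>' \<theta> i x = 0"
proof -
  \<comment> \<open>Dependent choice of pairs (\<theta>, \<delta>). The clause for n = 0 fixes the
    start, so that the \<theta> are exactly the partial sums of the series.\<close>
  have "\<exists>s. \<forall>n. (approx n (fst (s n)) (snd (s n)) \<and> (n = 0 \<longrightarrow> fst (s n) = (\<lambda>_ _. 0)))
      \<and> (\<exists>\<gamma>\<in>hom_set A F F (- 1). fst (s (Suc n)) = (\<lambda>i x. fst (s n) i x + smul F (t ^ n) (\<gamma> i x)))"
  proof (rule dependent_nat_choice, goal_cases)
    case 1 show ?case using approx_0 by (intro exI[of _ "(\<lambda>_ _. 0, \<beta>)"]) simp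
  next
    case (2 s n)
    then obtain \<gamma> \<delta>' where "\<gamma> \<in> hom_set A F F (- 1)"
      "approx (Suc n) (\<lambda>i x. fst s i x + smul F (t ^ n) (\<gamma> i x)) \<delta>'"
      using approx_Suc[OF ext] by blast
    then show ?case
      by (intro exI[of _ "(\<lambda>i x. fst s i x + smul F (t ^ n) (\<gamma> i x), \<delta>')"]) auto
  qed
  then obtain s where S: "(approx n (fst (s n)) (snd (s n)) \<and> (n = 0 \<longrightarrow> fst (s n) = (\<lambda>_ _. 0)))
      \<and> (\<exists>\<gamma>\<in>hom_set A F F (- 1). fst (s (Suc n)) = (\<lambda>i x. fst (s n) i x + smul F (t ^ n) (\<gamma> i x)))"
    for n by (elim exE) auto
  have s: "approx n (fst (s n)) (snd (s n))" for n using S[of n] by simp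
  have s0: "fst (s 0) = (\<lambda>_ _. 0)" using S[of 0] by simp
  have "\<exists>\<gamma>. \<gamma> \<in> hom_set A F F (- 1) \<and>
      fst (s (Suc n)) = (\<lambda>i x. fst (s n) i x + smul F (t ^ n) (\<gamma> i x))" for n
    using S[of n] by auto
  then have "\<forall>n. \<exists>\<gamma>. \<gamma> \<in> hom_set A F F (- 1) \<and>
      fst (s (Suc n)) = (\<lambda>i x. fst (s n) i x + smul F (t ^ n) (\<gamma> i x))" ..
  from choice[OF this] obtain \<gamma> where G: "\<forall>n. \<gamma> n \<in> hom_set A F F (- 1) \<and>
      fst (s (Suc n)) = (\<lambda>i x. fst (s n) i x + smul F (t ^ n) (\<gamma> n i x))" by (elim exE)
  then have \<gamma>: "\<And>n. \<gamma> n \<in> hom_set A F F (- 1)" by blast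
  have sSuc: "fst (s (Suc n)) = (\<lambda>i x. fst (s n) i x + smul F (t ^ n) (\<gamma> n i x))" for n
    using G by blast
  have s_sum: "fst (s n) i x = (\<Sum>m<n. smul F (t ^ m) (\<gamma> m i x))" for n i x
    by (induction n) (simp_all add: s0 sSuc)
  obtain \<theta> where \<theta>: "\<theta> \<in> hom_set A F F (- 1)"
    and lim0: "\<And>i x n. x \<in> carr F i \<Longrightarrow> tcong t n (i + - 1) (\<theta> i x) (\<Sum>m<n. smul F (t ^ m) (\<gamma> m i x))"
  proof (rule hom_set_limit[OF complete, where \<gamma> = \<gamma>, OF \<gamma>])
    fix \<theta> assume "\<theta> \<in> hom_set A F F (- 1)" and "\<And>i x n. x \<in> carr F i \<Longrightarrow>
      tcong t n (i + - 1) (\<theta> i x) (\<Sum>m<n. smul F (t ^ m) (\<gamma> m i x))"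
    then show thesis by (rule that)
  qed
  have lim: "tcong t n (i - 1) (\<theta> i x) (fst (s n) i x)" if "x \<in> carr F i" for n i x
    using lim0[OF that, of n] by (simp add: s_sum)
  note \<theta>_simps = hom1D[OF \<theta>]
  have \<theta>_lin: "rlin (smul F) (carr F i) (smul F) (carr F (i - 1)) (\<theta> i)" for i
    using \<theta> by (simp add: hom_set_def)
  have "\<beta>' \<theta> i x = 0" if x: "x \<in> carr F i" for i x
  proof (rule tcong_unique[OF complete[of "i - 2"]])
    fix n
    let ?\<theta> = "fst (s n)" and ?\<delta> = "snd (s n)"
    have "approx n ?\<theta> ?\<delta>" using s .
    then have h: "?\<theta> \<in> hom_set A F F (- 1)" and d: "?\<delta> i x \<in> carr F (i - 2)"
      and eq: "\<beta>' ?\<theta> i x = smul F (t ^ n) (?\<delta> i x)"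
      using x hom2D(1) by (auto simp: approx_def)
    note h_simps = hom1D[OF h]
    have 1: "tcong t n (i - 2) (\<alpha> (i - 1) (\<theta> i x)) (\<alpha> (i - 1) (?\<theta> i x))"
      using tcong_map[OF lim[OF x] \<alpha>_lin] x by (simp add: \<theta>_simps h_simps)
    have 2: "tcong t n (i - 2) (\<theta> (i - 1) (\<alpha> i x)) (?\<theta> (i - 1) (\<alpha> i x))"
      using lim[of "\<alpha> i x" "i - 1" n] x by (simp add: \<alpha>_simps)
    \<comment> \<open>The quadratic term is compared one factor at a time: the inner factor by
      linearity of the limit \<theta>, the outer one by convergence at the point
      \<open>?\<theta> i x\<close>.\<close>
    have "tcong t n (i - 2) (\<theta> (i - 1) (\<theta> i x)) (\<theta> (i - 1) (?\<theta> i x))"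
      using tcong_map[OF lim[OF x] \<theta>_lin] x by (simp add: \<theta>_simps h_simps)
    moreover have "tcong t n (i - 2) (\<theta> (i - 1) (?\<theta> i x)) (?\<theta> (i - 1) (?\<theta> i x))"
      using lim[of "?\<theta> i x" "i - 1" n] x by (simp add: h_simps)
    ultimately have "tcong t n (i - 2) (\<theta> (i - 1) (\<theta> i x)) (?\<theta> (i - 1) (?\<theta> i x))"
      by (rule tcong_trans)
    then have 3: "tcong t n (i - 2) (smul F t (\<theta> (i - 1) (\<theta> i x))) (smul F t (?\<theta> (i - 1) (?\<theta> i x)))"
      using x by (intro tcong_map[OF _ rlin_smul_const]) (simp_all add: \<theta>_simps h_simps)
    have "tcong t n (i - 2) (\<beta>' \<theta> i x) (\<beta>' ?\<theta> i x)"
      unfolding \<beta>'_def by (intro tcong_diff tcong_refl 1 2 3)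
    moreover have "tcong t n (i - 2) (\<beta>' ?\<theta> i x) 0"
      unfolding tcong_def eq using d by auto
    ultimately show "tcong t n (i - 2) (\<beta>' \<theta> i x) 0" by (rule tcong_trans)
  qed (use x in \<open>simp_all add: \<beta>'_def \<alpha>_simps \<beta>_simps \<theta>_simps\<close>)
  with \<theta> show thesis by (rule that)
qed

text \<open>With \<beta> zero on the carriers, \<open>square\<close> makes \<alpha> a genuine
  differential, and the twisted differential agrees with that of the base change, so the identity is
  an isomorphism.\<close>

lemma dg_iso_bchg:
  assumes "\<And>i x. x \<in> carr F i \<Longrightarrow> \<beta> i x = 0"
  shows "is_dgm A (F\<lparr>dif := \<alpha>\<rparr>)"
    and "dg_iso (kos A t) (twist t F \<alpha> \<beta>) (bchg t (F\<lparr>dif := \<alpha>\<rparr>))"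
proof -
  have "\<alpha> (i - 1) (\<alpha> i x) = 0" if "x \<in> carr F i" for i x
    using square[OF that] assms[OF that] by simp
  then show "is_dgm A (F\<lparr>dif := \<alpha>\<rparr>)"
    by (auto simp: is_dgm_def is_cx_def rmod_carr \<alpha>_lin act_add_left act_add_right act_smul_left
        act_smul_right \<alpha>_act act_act act_one)
  show "dg_iso (kos A t) (twist t F \<alpha> \<beta>) (bchg t (F\<lparr>dif := \<alpha>\<rparr>))"
    using assms
    by (intro dg_isoI[of _ _ _ "\<lambda>_ u. u"])
      (auto simp: dg_hom_def rlin_def twist_def bchg_def bij_betw_def)
qed

lemma dg_iso_lift:
  assumes ext: "ext_zero (kos A t) (twist t F \<alpha> \<beta>) (twist t F \<alpha> \<beta>) 2"
    and complete: "\<And>i. tadic_complete t (smul F) (carr F i)"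
  obtains \<alpha>0 where "is_dgm A (F\<lparr>dif := \<alpha>0\<rparr>)"
    and "dg_iso (kos A t) (twist t F \<alpha> \<beta>) (bchg t (F\<lparr>dif := \<alpha>0\<rparr>))"
proof -
  obtain \<theta> where \<theta>: "\<theta> \<in> hom_set A F F (- 1)" "\<And>i x. x \<in> carr F i \<Longrightarrow> \<beta>' \<theta> i x = 0"
    using exists_change[OF ext complete] by blast
  interpret K: koszul_module F A t "\<alpha>' \<theta>" "\<beta>' \<theta>" by (rule koszul_module_change[OF \<theta>(1)])
  show thesis
    using that K.dg_iso_bchg[OF \<theta>(2)] dg_iso_trans[OF dg_iso_change[OF \<theta>(1)]] by blast
qed

end

section \<open>Coordinates with respect to a semi-basis\<close>

lemma sum_apply2: "(sum f K) x y = (\<Sum>k\<in>K. f k x y)"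
  by (induction K rule: infinite_finite_induct) auto

lemma graded_act_dgm:
  assumes "\<And>i. rmod (smul B) (carr B i)" "is_dgm B M"
  shows "graded_act M B"
  using assms(2) unfolding is_dgm_def is_cx_def by unfold_locales (simp_all add: assms(1))

lemma choice2: "(\<And>j e. \<exists>s. P j e s) \<Longrightarrow> \<exists>s. \<forall>j e. P j e (s j e)"
  by (intro choice allI)

lemma dga_rmod: "is_dga A \<Longrightarrow> rmod (smul A) (carr A i)"
  by (simp add: is_dga_def is_cx_def)

lemma dgaD:
  assumes "is_dga A"
  shows "a \<in> carr A i \<Longrightarrow> b \<in> carr A j \<Longrightarrow> mul A i j a b \<in> carr A (i + j)"
    and "a \<in> carr A i \<Longrightarrow> a' \<in> carr A i \<Longrightarrow> b \<in> carr A j \<Longrightarrow>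
      mul A i j (a + a') b = mul A i j a b + mul A i j a' b"
    and "a \<in> carr A i \<Longrightarrow> b \<in> carr A j \<Longrightarrow> b' \<in> carr A j \<Longrightarrow>
      mul A i j a (b + b') = mul A i j a b + mul A i j a b'"
    and "a \<in> carr A i \<Longrightarrow> b \<in> carr A j \<Longrightarrow> mul A i j (smul A r a) b = smul A r (mul A i j a b)"
    and "a \<in> carr A i \<Longrightarrow> b \<in> carr A j \<Longrightarrow> mul A i j a (smul A r b) = smul A r (mul A i j a b)"
    and "a \<in> carr A i \<Longrightarrow> b \<in> carr A j \<Longrightarrow> c \<in> carr A k \<Longrightarrow>
      mul A (i + j) k (mul A i j a b) c = mul A i (j + k) a (mul A j k b c)"
    and "a \<in> carr A i \<Longrightarrow> mul A 0 i (one A) a = a" "a \<in> carr A i \<Longrightarrow> mul A i 0 a (one A) = a"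
    and "one A \<in> carr A 0" "i < 0 \<Longrightarrow> carr A i = {0}"
    and "rlin (smul A) (carr A i) (smul A) (carr A (i - 1)) (dif A i)"
  \<comment> \<open>Graded commutativity is left out because it loops as a rewrite rule.\<close>
  by (simp_all add: assms[unfolded is_dga_def is_cx_def, THEN conjunct1]
    assms[unfolded is_dga_def, THEN conjunct2, THEN conjunct1]
    assms[unfolded is_dga_def, THEN conjunct2, THEN conjunct2, THEN conjunct1]
    assms[unfolded is_dga_def, THEN conjunct2, THEN conjunct2, THEN conjunct2, THEN conjunct1]
    assms[unfolded is_dga_def, THEN conjunct2, THEN conjunct2, THEN conjunct2, THEN conjunct2,
      THEN conjunct1]
    assms[unfolded is_dga_def, THEN conjunct2, THEN conjunct2, THEN conjunct2, THEN conjunct2,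
      THEN conjunct2, THEN conjunct1]
    assms[unfolded is_dga_def, THEN conjunct2, THEN conjunct2, THEN conjunct2, THEN conjunct2,
      THEN conjunct2, THEN conjunct2, THEN conjunct2, THEN conjunct1]
    assms[unfolded is_dga_def, THEN conjunct2, THEN conjunct2, THEN conjunct2, THEN conjunct2,
      THEN conjunct2, THEN conjunct2, THEN conjunct2, THEN conjunct2, THEN conjunct1]
    assms[unfolded is_dga_def, THEN conjunct2, THEN conjunct2, THEN conjunct2, THEN conjunct2,
      THEN conjunct2, THEN conjunct2, THEN conjunct2, THEN conjunct2, THEN conjunct2,
      THEN conjunct1])

text \<open>Regarding A as a module over itself makes closure and zero laws of the product instances
  of those for actions.\<close>

definition self_mod :: "('r, 'a) dga \<Rightarrow> ('r, 'a, 'a) dgm" where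
  "self_mod A = \<lparr>carr = carr A, smul = smul A, dif = dif A, act = mul A\<rparr>"

lemma graded_act_self: "is_dga A \<Longrightarrow> graded_act (self_mod A) A"
  by unfold_locales (simp_all add: self_mod_def dgaD dga_rmod)

lemma rmod_kos:
  assumes "is_dga A" shows "rmod (smul (kos A t)) (carr (kos A t) i)"
proof -
  interpret graded_rmod A by unfold_locales (rule dga_rmod[OF assms])
  show ?thesis
    by (auto simp: rmod_def twist_simps zero_prod_def smul_add add_smul smul_smul smul_one)
qed

text \<open>The differential of this module is a placeholder.\<close>
definition coord_mod :: "('r, 'a::ab_group_add) dga \<Rightarrow> (int \<Rightarrow> 'n set) \<Rightarrow> ('r, 'a, int \<Rightarrow> 'n \<Rightarrow> 'a) dgm" where
  "coord_mod A E = \<lparr>carr = (\<lambda>n. {c. \<forall>j e. (e \<in> E j \<longrightarrow> c j e \<in> carr A (n - j)) \<and> (e \<notin> E j \<longrightarrow> c j e = 0)}),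
     smul = (\<lambda>r c j e. smul A r (c j e)), dif = (\<lambda>_ c. c),
     act = (\<lambda>i n a c j e. mul A i (n - j) a (c j e))\<rparr>"

lemma coord_mod_simps:
  "c \<in> carr (coord_mod A E) n \<longleftrightarrow> (\<forall>j e. (e \<in> E j \<longrightarrow> c j e \<in> carr A (n - j)) \<and> (e \<notin> E j \<longrightarrow> c j e = 0))"
  "smul (coord_mod A E) r c j e = smul A r (c j e)"
  "act (coord_mod A E) i n a c j e = mul A i (n - j) a (c j e)"
  by (simp_all add: coord_mod_def)

locale dga_mod =
  fixes A :: "('r::comm_ring_1, 'a::ab_group_add) dga"
  assumes dga: "is_dga A"
begin

sublocale graded_rmod A by unfold_locales (rule dga_rmod[OF dga])

interpretation S: graded_act "self_mod A" A by (rule graded_act_self[OF dga])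

lemma mul_mem: "a \<in> carr A i \<Longrightarrow> b \<in> carr A j \<Longrightarrow> k = i + j \<Longrightarrow> mul A i j a b \<in> carr A k"
  and mul_zero_right: "a \<in> carr A i \<Longrightarrow> mul A i j a 0 = 0"
  and mul_zero_left: "b \<in> carr A j \<Longrightarrow> mul A i j 0 b = 0"
  using S.act_mem[of a i b j k] S.act_zero_right[of a i j] S.act_zero_left[of b j i]
  by (simp_all add: self_mod_def)

lemma mul_one_left: "a \<in> carr A i \<Longrightarrow> mul A 0 i (one A) a = a"
  and mul_one_right: "a \<in> carr A i \<Longrightarrow> mul A i 0 a (one A) = a"
  and neg_zero: "i < 0 \<Longrightarrow> carr A i = {0}"
  and one_mem: "one A \<in> carr A 0"
  using dgaD[OF dga] by auto

lemma carr_trivial: "one A = 0 \<Longrightarrow> a \<in> carr A i \<Longrightarrow> a = 0"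
  using mul_one_left[of a i] mul_zero_left[of a i] by simp

lemma coord_memD:
  assumes "c \<in> carr (coord_mod A E) n"
  shows "c j e \<in> carr A (n - j)"
  using assms by (cases "e \<in> E j") (auto simp: coord_mod_simps)

lemma graded_act_coord: "graded_act (coord_mod A E) A"
proof
  note D = coord_memD[of _ E]
  show "rmod (smul (coord_mod A E)) (carr (coord_mod A E) i)" for i
    unfolding rmod_def
  proof (intro conjI ballI allI)
    show "0 \<in> carr (coord_mod A E) i" by (simp add: coord_mod_simps)
    fix x assume x: "x \<in> carr (coord_mod A E) i"
    then show "- x \<in> carr (coord_mod A E) i" and "smul (coord_mod A E) r x \<in> carr (coord_mod A E) i" for r
      by (simp_all add: coord_mod_simps)
    show "smul (coord_mod A E) (r + s) x = smul (coord_mod A E) r x + smul (coord_mod A E) s x"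
      and "smul (coord_mod A E) (r * s) x = smul (coord_mod A E) r (smul (coord_mod A E) s x)"
      and "smul (coord_mod A E) 1 x = x" for r s
      by (intro ext; simp add: coord_mod_simps add_smul[OF D[OF x]] smul_smul[OF D[OF x]] smul_one[OF D[OF x]])+
    fix y assume y: "y \<in> carr (coord_mod A E) i"
    then show "x + y \<in> carr (coord_mod A E) i" using x by (simp add: coord_mod_simps)
    show "smul (coord_mod A E) r (x + y) = smul (coord_mod A E) r x + smul (coord_mod A E) r y" for r
      by (intro ext) (simp add: coord_mod_simps smul_add[OF D[OF x] D[OF y]])
  qed
  show "rmod (smul A) (carr A i)" for i by (rule dga_rmod[OF dga])
  fix a i x j assume a: "a \<in> carr A i" and x: "x \<in> carr (coord_mod A E) j"
  then show "act (coord_mod A E) i j a x \<in> carr (coord_mod A E) (i + j)"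
    by (simp add: coord_mod_simps mul_mem mul_zero_right)
  show "act (coord_mod A E) i j (smul A r a) x = smul (coord_mod A E) r (act (coord_mod A E) i j a x)"
    "act (coord_mod A E) i j a (smul (coord_mod A E) r x) = smul (coord_mod A E) r (act (coord_mod A E) i j a x)" for r
    using a D[OF x] by (intro ext; simp add: coord_mod_simps dgaD[OF dga])+
  show "act (coord_mod A E) i j (a + a') x = act (coord_mod A E) i j a x + act (coord_mod A E) i j a' x"
    if "a' \<in> carr A i" for a'
    using a D[OF x] that by (intro ext) (simp add: coord_mod_simps dgaD[OF dga])
  show "act (coord_mod A E) i j a (x + y) = act (coord_mod A E) i j a x + act (coord_mod A E) i j a y"
    if "y \<in> carr (coord_mod A E) j" for y
    using a D[OF x] D[OF that] by (intro ext) (simp add: coord_mod_simps dgaD[OF dga])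
next
  fix a i b j x k assume "a \<in> carr A i" "b \<in> carr A j" and x: "x \<in> carr (coord_mod A E) k"
  then show "act (coord_mod A E) i (j + k) a (act (coord_mod A E) j k b x)
      = act (coord_mod A E) (i + j) k (mul A i j a b) x"
    using coord_memD[OF x] by (intro ext) (simp add: coord_mod_simps dgaD(6)[OF dga] add_diff_eq)
next
  fix x j assume x: "x \<in> carr (coord_mod A E) j"
  then show "act (coord_mod A E) 0 j (one A) x = x"
    by (intro ext) (simp add: coord_mod_simps mul_one_left coord_memD[OF x])
qed

text \<open>The carriers of \<open>coord_mod\<close> impose no finite support, so each is a product
  of components of A and both halves of completeness hold coordinatewise. An infinite direct sum
  would in general not contain such limits.\<close>

lemma tadic_complete_coord:
  assumes complete: "\<And>i. tadic_complete t (smul A) (carr A i)"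
  shows "tadic_complete t (smul (coord_mod A E)) (carr (coord_mod A E) n)"
  unfolding tadic_complete_def
proof (intro conjI allI impI ballI)
  fix y :: "nat \<Rightarrow> int \<Rightarrow> 'b \<Rightarrow> 'a" assume "\<forall>k. y k \<in> carr (coord_mod A E) n"
  then have y: "y k \<in> carr (coord_mod A E) n" for k by simp
  \<comment> \<open>Off \<open>E j\<close> the limit and the quotients are forced to be 0, so that
    the chosen families lie in the carrier.\<close>
  have ex: "\<exists>s. (e \<in> E j \<longrightarrow> s \<in> carr A (n - j)) \<and> (e \<notin> E j \<longrightarrow> s = 0) \<and>
      (\<forall>k. \<exists>z. (e \<in> E j \<longrightarrow> z \<in> carr A (n - j)) \<and> (e \<notin> E j \<longrightarrow> z = 0) \<and>
        s - (\<Sum>m<k. smul A (t ^ m) (y m j e)) = smul A (t ^ k) z)" for j e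
  proof (cases "e \<in> E j")
    case True
    have "\<forall>k. y k j e \<in> carr A (n - j)" using coord_memD[OF y] by blast
    then have "\<exists>s\<in>carr A (n - j). \<forall>k. \<exists>z\<in>carr A (n - j). s - (\<Sum>m<k. smul A (t ^ m) (y m j e)) = smul A (t ^ k) z"
      using complete[of "n - j"] unfolding tadic_complete_def by simp
    then show ?thesis using True unfolding Bex_def by simp
  next
    case False
    then have "y m j e = 0" for m using y[of m] by (simp add: coord_mod_simps)
    then show ?thesis using False by simp
  qed
  have "\<exists>s. \<forall>j e. (e \<in> E j \<longrightarrow> s j e \<in> carr A (n - j)) \<and>
      (e \<notin> E j \<longrightarrow> s j e = 0) \<and>
      (\<forall>k. \<exists>z. (e \<in> E j \<longrightarrow> z \<in> carr A (n - j)) \<and> (e \<notin> E j \<longrightarrow> z = 0) \<and>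
        s j e - (\<Sum>m<k. smul A (t ^ m) (y m j e)) = smul A (t ^ k) z)"
    by (rule choice2) (rule ex)
  then obtain s where S: "\<forall>j e. (e \<in> E j \<longrightarrow> s j e \<in> carr A (n - j)) \<and>
      (e \<notin> E j \<longrightarrow> s j e = 0) \<and>
      (\<forall>k. \<exists>z. (e \<in> E j \<longrightarrow> z \<in> carr A (n - j)) \<and> (e \<notin> E j \<longrightarrow> z = 0) \<and>
        s j e - (\<Sum>m<k. smul A (t ^ m) (y m j e)) = smul A (t ^ k) z)"
    by (elim exE)
  have "\<exists>z. \<forall>j e. (e \<in> E j \<longrightarrow> z j e \<in> carr A (n - j)) \<and> (e \<notin> E j \<longrightarrow> z j e = 0) \<and>
        s j e - (\<Sum>m<k. smul A (t ^ m) (y m j e)) = smul A (t ^ k) (z j e)" for k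
    by (rule choice2) (use S in blast)
  then have "\<forall>k. \<exists>z. \<forall>j e. (e \<in> E j \<longrightarrow> z j e \<in> carr A (n - j)) \<and> (e \<notin> E j \<longrightarrow> z j e = 0) \<and>
        s j e - (\<Sum>m<k. smul A (t ^ m) (y m j e)) = smul A (t ^ k) (z j e)" by (rule allI)
  from choice[OF this] obtain z where z: "\<forall>k j e. (e \<in> E j \<longrightarrow> z k j e \<in> carr A (n - j)) \<and>
        (e \<notin> E j \<longrightarrow> z k j e = 0) \<and>
        s j e - (\<Sum>m<k. smul A (t ^ m) (y m j e)) = smul A (t ^ k) (z k j e)"
    by (elim exE)
  have "s - (\<Sum>m<k. smul (coord_mod A E) (t ^ m) (y m)) = smul (coord_mod A E) (t ^ k) (z k)" for k
    using z by (intro ext) (simp add: sum_apply2 coord_mod_simps)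
  moreover have "s \<in> carr (coord_mod A E) n" "z k \<in> carr (coord_mod A E) n" for k
    using S z by (simp_all add: coord_mod_simps)
  ultimately show "\<exists>s\<in>carr (coord_mod A E) n. \<forall>k. \<exists>z\<in>carr (coord_mod A E) n.
      s - (\<Sum>m<k. smul (coord_mod A E) (t ^ m) (y m)) = smul (coord_mod A E) (t ^ k) z"
    by blast
next
  fix u assume u: "u \<in> carr (coord_mod A E) n"
    and div: "\<forall>k. \<exists>z\<in>carr (coord_mod A E) n. u = smul (coord_mod A E) (t ^ k) z"
  have "u j e = 0" for j e
  proof -
    have "\<exists>z\<in>carr A (n - j). u j e = smul A (t ^ k) z" for k
    proof -
      obtain z where z: "z \<in> carr (coord_mod A E) n" "u = smul (coord_mod A E) (t ^ k) z"
        using div by blast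
      show ?thesis using coord_memD[OF z(1)] by (intro bexI[of _ "z j e"]) (simp_all add: z(2) coord_mod_simps)
    qed
    then show ?thesis using complete[of "n - j"] coord_memD[OF u] unfolding tadic_complete_def by blast
  qed
  then show "u = 0" by (intro ext) simp
qed

text \<open>D is determined by its values on \<open>(x, 0)\<close>: as (0, y) is X times (y, 0), the
  Leibniz rule gives D(Xy) = ty - X D(y), and X X = 0 kills the \<beta> part of D(y). The conditions
  on \<alpha> and \<beta> are then the Leibniz rule and D D = 0 read on
  \<open>(x, 0)\<close>.\<close>

lemma koszul_module_of_dif:
  assumes F: "graded_act F A"
    and D_mem: "\<And>i u. u \<in> carr (bchg t F) i \<Longrightarrow> D i u \<in> carr (bchg t F) (i - 1)"
    and D_add: "\<And>i u v. u \<in> carr (bchg t F) i \<Longrightarrow> v \<in> carr (bchg t F) i \<Longrightarrow> D i (u + v) = D i u + D i v"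
    and D_smul: "\<And>i r u. u \<in> carr (bchg t F) i \<Longrightarrow> D i (smul (bchg t F) r u) = smul (bchg t F) r (D i u)"
    and D_act: "\<And>i j b u. b \<in> carr (kos A t) i \<Longrightarrow> u \<in> carr (bchg t F) j \<Longrightarrow>
      D (i + j) (act (bchg t F) i j b u) = act (bchg t F) (i - 1) j (dif (kos A t) i b) u
        + sgnact i (act (bchg t F) i (j - 1) b (D j u))"
    and D_D: "\<And>i u. u \<in> carr (bchg t F) i \<Longrightarrow> D (i - 1) (D i u) = 0"
  obtains \<alpha> \<beta> where "koszul_module F A t \<alpha> \<beta>"
    and "\<And>i u. u \<in> carr (bchg t F) i \<Longrightarrow> D i u = dif (twist t F \<alpha> \<beta>) i u"
proof -
  interpret F: graded_act F A by (rule F)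
  define \<alpha> where "\<alpha> = (\<lambda>i x. fst (D i (x, 0)))"
  define \<beta> where "\<beta> = (\<lambda>i x. snd (D i (x, 0)))"
  have bchg_simps: "carr (bchg t F) i = carr F i \<times> carr F (i - 1)"
    "smul (bchg t F) r (x, y) = (smul F r x, smul F r y)"
    "act (bchg t F) i j (a, b) (x, y) = (act F i j a x, act F (i - 1) j b x + sgnact i (act F i (j - 1) a y))"
    for i j r x y a b by (simp_all add: bchg_def)
  have Dx: "D i (x, 0) = (\<alpha> i x, \<beta> i x)" for i x by (simp add: \<alpha>_def \<beta>_def)
  have mem: "\<alpha> i x \<in> carr F (i - 1)" "\<beta> i x \<in> carr F (i - 2)" if "x \<in> carr F i" for i x
    using D_mem[of "(x, 0)" i] that by (auto simp: bchg_simps Dx)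
  have add: "\<alpha> i (x + y) = \<alpha> i x + \<alpha> i y" "\<beta> i (x + y) = \<beta> i x + \<beta> i y"
    if "x \<in> carr F i" "y \<in> carr F i" for i x y
    using D_add[of "(x, 0)" i "(y, 0)"] that by (auto simp: bchg_simps Dx)
  have smul: "\<alpha> i (smul F r x) = smul F r (\<alpha> i x)" "\<beta> i (smul F r x) = smul F r (\<beta> i x)"
    if "x \<in> carr F i" for i x r
    using D_smul[of "(x, 0)" i r] that by (auto simp: bchg_simps Dx)
  have difA: "dif A i a \<in> carr A (i - 1)" "dif A i 0 = 0" if "a \<in> carr A i" for i a
    using that rlin_mem[OF dgaD(11)[OF dga]] rlin_zero[OF dgaD(11)[OF dga]] by auto
  have difA0: "dif A i 0 = 0" for i using difA(2)[of 0] by simp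
  have act: "\<alpha> (i + j) (act F i j a x) = act F (i - 1) j (dif A i a) x + sgnact i (act F i (j - 1) a (\<alpha> j x))"
    "\<beta> (i + j) (act F i j a x) = act F i (j - 2) a (\<beta> j x)"
    if a: "a \<in> carr A i" and x: "x \<in> carr F j" for i j a x
    using D_act[of "(a, 0)" i "(x, 0)" j] a x difA[OF a] mem[OF x]
    by (auto simp: bchg_simps carr_kos dif_kos Dx sgnact_Pair difA0)
  have Dy: "D i (0, y) = (smul F t y, - \<alpha> (i - 1) y)" if y: "y \<in> carr F (i - 1)" for i y
  proof -
    \<comment> \<open>The differential of 1 lies in degree -1, where A vanishes. Hence d X = t with
      no X component.\<close>
    have "dif A 0 (one A) = 0" using difA[OF one_mem] neg_zero[of "- 1"] by simp
    moreover have "act (bchg t F) 1 (i - 1) (0, one A) (y, 0) = (0, y)"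
      using y by (simp add: bchg_simps one_mem F.act_one)
    ultimately show ?thesis
      using D_act[of "(0, one A)" 1 "(y, 0)" "i - 1"] y mem[OF y] 
      by (simp add: bchg_simps carr_kos dif_kos one_mem Dx difA0 F.act_one F.act_smul_left)
  qed
  have Dxy: "D i (x, y) = (\<alpha> i x + smul F t y, \<beta> i x - \<alpha> (i - 1) y)"
    if "x \<in> carr F i" "y \<in> carr F (i - 1)" for i x y
    using D_add[of "(x, 0)" i "(0, y)"] that by (simp add: bchg_simps Dx Dy)
  have "koszul_module F A t \<alpha> \<beta>"
  proof
    show "is_dga A" by (rule dga)
    show "graded_deriv A F \<alpha>"
      using mem add smul act by (simp add: graded_deriv_def rlin_def)
    show "\<beta> \<in> hom_set A F F (- 2)"
      using mem add smul act by (intro F.hom2I) auto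
    show "\<alpha> (i - 1) (\<alpha> i x) + smul F t (\<beta> i x) = 0" "\<alpha> (i - 2) (\<beta> i x) = \<beta> (i - 1) (\<alpha> i x)"
      if x: "x \<in> carr F i" for x i
      using D_D[of "(x, 0)" i] x mem[OF x] by (auto simp: bchg_simps Dx Dxy zero_prod_def)
  qed
  then show thesis
    using Dxy by (intro that) (auto simp: bchg_simps dif_twist)
qed


section \<open>A semi-basis of the coordinate module\<close>

definition unit_vec :: "int \<Rightarrow> 'n \<Rightarrow> int \<Rightarrow> 'n \<Rightarrow> 'a" where
  "unit_vec j e = (\<lambda>j' e'. if j' = j \<and> e' = e then one A else 0)"

lemma unit_vec_apply: "unit_vec j e j' e' = (if j' = j \<and> e' = e then one A else 0)"
  by (simp add: unit_vec_def)

lemma unit_vec_inj: "one A \<noteq> 0 \<Longrightarrow> unit_vec j e = unit_vec j' e' \<longleftrightarrow> j = j' \<and> e = e'"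
  unfolding unit_vec_def fun_eq_iff by metis

text \<open>At an index (j, e) injectivity of \<open>unit_vec\<close> leaves at most one summand,
  which contributes its coefficient times 1. So coefficients on unit vectors and coordinates are the
  same thing.\<close>

lemma unit_vec_lincomb:
  fixes c :: "int \<Rightarrow> (int \<Rightarrow> 'n \<Rightarrow> 'a) \<Rightarrow> 'a"
  assumes one: "one A \<noteq> 0"
    and fin: "finite {(j, b). b \<in> unit_vec j ` E j \<and> c j b \<noteq> 0}"
    and c: "\<And>j b. b \<in> unit_vec j ` E j \<Longrightarrow> c j b \<in> carr A (n - j)"
  shows "(\<Sum>(j, b)\<in>{(j, b). b \<in> unit_vec j ` E j \<and> c j b \<noteq> 0}.
      act (coord_mod A E) (n - j) j (c j b) b) =
    (\<lambda>j e. if e \<in> E j then c j (unit_vec j e) else 0)" (is "sum ?f ?S = _")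
proof (intro ext)
  fix j e
  have "(\<Sum>p\<in>?S. ?f p j e)
      = (\<Sum>p\<in>?S. if p = (j, unit_vec j e) then c j (unit_vec j e) else 0)"
  proof (intro sum.cong refl)
    fix p assume "p \<in> ?S"
    then obtain j' e' where p: "p = (j', unit_vec j' e')" "e' \<in> E j'" by auto
    then have "c j' (unit_vec j' e') \<in> carr A (n - j')" using c by blast
    then show "?f p j e = (if p = (j, unit_vec j e) then c j (unit_vec j e) else 0)"
      using one by (auto simp: p coord_mod_simps unit_vec_inj unit_vec_apply mul_zero_right mul_one_right)
  qed
  also have "\<dots> = (if (j, unit_vec j e) \<in> ?S then c j (unit_vec j e) else 0)"
    using fin by simp
  also have "\<dots> = (if e \<in> E j then c j (unit_vec j e) else 0)"
    using one by (auto simp: unit_vec_inj image_iff)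
  finally show "sum ?f ?S j e = (if e \<in> E j then c j (unit_vec j e) else 0)"
    by (simp add: sum_apply2)
qed

text \<open>The coordinates of x serve as coefficients on the unit vectors and are forced by
  \<open>unit_vec_lincomb\<close>. Finite support is a premise because the carriers do not impose
  it.\<close>

lemma semibasis_coord:
  assumes fin: "\<And>n x. x \<in> carr (coord_mod A E) n \<Longrightarrow> finite {(j, e). e \<in> E j \<and> x j e \<noteq> 0}"
  shows "\<exists>E'. semibasis A (coord_mod A E) E'"
proof (cases "one A = 0")
  \<comment> \<open>If 1 = 0 in A the unit vectors need not be distinct, but then all components
    vanish and the empty family is a semi-basis.\<close>
  case True
  then have "x = 0" if "x \<in> carr (coord_mod A E) n" for x n
    using carr_trivial[OF True coord_memD[OF that]] by (intro ext) simp
  then have "semibasis A (coord_mod A E) (\<lambda>_. {})"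
    unfolding semibasis_def by (auto intro!: ex1I[of _ "\<lambda>_ _. 0"] ext)
  then show ?thesis by (rule exI[of _ "\<lambda>_. {}"])
next
  case False
  let ?E = "\<lambda>j. unit_vec j ` E j"
  have "semibasis A (coord_mod A E) ?E"
    unfolding semibasis_def
  proof (intro conjI allI ballI)
    show "?E j \<subseteq> carr (coord_mod A E) j" for j
      by (auto simp: coord_mod_simps unit_vec_def one_mem)
    fix n x assume x: "x \<in> carr (coord_mod A E) n"
    define c where "c = (\<lambda>j b. if b \<in> ?E j then x j (inv_into (E j) (unit_vec j) b) else 0)"
    have inj: "inj_on (unit_vec j) (E j)" for j by (auto simp: inj_on_def unit_vec_inj[OF False])
    have c_unit: "c j (unit_vec j e) = x j e" if "e \<in> E j" for j e
      using that by (simp add: c_def inv_into_f_f[OF inj])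
    show "\<exists>!c. finite {(j, b). b \<in> ?E j \<and> c j b \<noteq> 0} \<and> (\<forall>j b. b \<in> ?E j \<longrightarrow> c j b \<in> carr A (n - j))
        \<and> (\<forall>j b. b \<notin> ?E j \<longrightarrow> c j b = 0)
        \<and> x = (\<Sum>(j, b)\<in>{(j, b). b \<in> ?E j \<and> c j b \<noteq> 0}. act (coord_mod A E) (n - j) j (c j b) b)"
    proof (rule ex1I[of _ c], intro conjI allI impI)
      have "{(j, b). b \<in> ?E j \<and> c j b \<noteq> 0} \<subseteq> (\<lambda>(j, e). (j, unit_vec j e)) ` {(j, e). e \<in> E j \<and> x j e \<noteq> 0}"
        using c_unit by force
      then show f: "finite {(j, b). b \<in> ?E j \<and> c j b \<noteq> 0}"
        using fin[OF x] finite_surj by blast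
      show m: "c j b \<in> carr A (n - j)" if "b \<in> ?E j" for j b
        using that c_unit coord_memD[OF x] by auto
      show "c j b = 0" if "b \<notin> ?E j" for j b using that by (simp add: c_def)
      have "(\<lambda>j e. if e \<in> E j then c j (unit_vec j e) else 0) = x"
        using x by (intro ext) (simp add: c_unit coord_mod_simps)
      then show "x = (\<Sum>(j, b)\<in>{(j, b). b \<in> ?E j \<and> c j b \<noteq> 0}. act (coord_mod A E) (n - j) j (c j b) b)"
        using unit_vec_lincomb[where c = c and E = E and n = n, OF False f m] by simp
    next
      fix d assume d: "finite {(j, b). b \<in> ?E j \<and> d j b \<noteq> 0} \<and> (\<forall>j b. b \<in> ?E j \<longrightarrow> d j b \<in> carr A (n - j))
        \<and> (\<forall>j b. b \<notin> ?E j \<longrightarrow> d j b = 0)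
        \<and> x = (\<Sum>(j, b)\<in>{(j, b). b \<in> ?E j \<and> d j b \<noteq> 0}. act (coord_mod A E) (n - j) j (d j b) b)"
      then have "x = (\<lambda>j e. if e \<in> E j then d j (unit_vec j e) else 0)"
        using unit_vec_lincomb[where c = d and E = E and n = n, OF False] by simp
      then have "x j e = d j (unit_vec j e)" if "e \<in> E j" for j e
        using that by (simp only: if_True)
      then have "d j (unit_vec j e) = c j (unit_vec j e)" if "e \<in> E j" for j e
        using that c_unit by simp
      then have "d j b = c j b" if "b \<in> ?E j" for j b using that by blast
      moreover have "d j b = 0" "c j b = 0" if "b \<notin> ?E j" for j b
        using that d by (simp_all add: c_def)
      ultimately show "d = c" by (intro ext) metis
    qed
  qed
  then show ?thesis by (rule exI[of _ ?E])
qed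

end

section \<open>Twisted form of a semi-free module over the Koszul extension\<close>

locale semifree_finite = dga_mod A + N: graded_act N "kos A t"
  for A :: "('r::comm_ring_1, 'a::ab_group_add) dga" and t :: 'r
    and N :: "('r, 'a \<times> 'a, 'n::ab_group_add) dgm" +
  fixes E :: "int \<Rightarrow> 'n set" and n0 :: int
  assumes dgm: "is_dgm (kos A t) N"
    and bounded: "i < n0 \<Longrightarrow> carr N i = {0}"
    and semibasis: "semibasis (kos A t) N E"
    and finite_E: "finite (E j)"
begin

text \<open>A model of the A-span of the semi-basis of N: coordinate functions on the same index
  set, with values in A instead of the Koszul extension.\<close>

abbreviation "F \<equiv> coord_mod A E"

sublocale F: graded_act F A by (rule graded_act_coord)

abbreviation is_coord :: "int \<Rightarrow> 'n \<Rightarrow> (int \<Rightarrow> 'n \<Rightarrow> 'a \<times> 'a) \<Rightarrow> bool" where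
  "is_coord n x c \<equiv> finite {(j, e). e \<in> E j \<and> c j e \<noteq> 0}
        \<and> (\<forall>j e. e \<in> E j \<longrightarrow> c j e \<in> carr (kos A t) (n - j))
        \<and> (\<forall>j e. e \<notin> E j \<longrightarrow> c j e = 0)
        \<and> x = (\<Sum>(j, e)\<in>{(j, e). e \<in> E j \<and> c j e \<noteq> 0}. act N (n - j) j (c j e) e)"

lemma E_mem: "e \<in> E j \<Longrightarrow> e \<in> carr N j"
  using semibasis by (auto simp: semibasis_def)

lemma ex1_coord: "x \<in> carr N n \<Longrightarrow> \<exists>!c. is_coord n x c"
  using semibasis unfolding semibasis_def by simp

text \<open>Basis elements of degree below the bound are zero, so they occur only if A is trivial.\<close>
lemma low_degree:
  assumes "e \<in> E j" "j < n0" "a \<in> carr A i" shows "a = 0"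
proof (rule carr_trivial[OF _ assms(3)])
  have e0: "e = 0" using E_mem[OF assms(1)] bounded[OF assms(2)] by simp
  \<comment> \<open>As e = 0, the element 0 has the expansion with coefficient 1 at e besides the
    empty one; uniqueness of coefficients gives 1 = 0.\<close>
  let ?c = "\<lambda>j' e'. if j' = j \<and> e' = e then (one A, 0 :: 'a) else 0"
  have S: "{(j', e'). e' \<in> E j' \<and> ?c j' e' \<noteq> 0} = (if one A = 0 then {} else {(j, e)})"
    using assms(1) by (auto simp: zero_prod_def)
  have one: "(one A, 0) \<in> carr (kos A t) 0" by (simp add: carr_kos one_mem)
  have "is_coord j 0 ?c"
    unfolding S using one assms(1) e0 by (auto simp: carr_kos zero_prod_def)
  moreover have "is_coord j 0 (\<lambda>_ _. 0)" by (auto simp: carr_kos zero_prod_def)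
  ultimately have "?c = (\<lambda>_ _. 0)" by (rule ex1_unique[OF ex1_coord[OF N.zero_mem[of j]]])
  then have "?c j e = 0" by (rule fun_cong[THEN fun_cong])
  then show "one A = 0" by (simp add: zero_prod_def)
qed

text \<open>In degree n the coefficient at a basis element of degree j has degree n - j, hence
  vanishes for j > n, and degrees below \<open>n0\<close> do not contribute. So \<open>T n\<close>
  contains every support in degree n, and it is finite.\<close>

definition T :: "int \<Rightarrow> (int \<times> 'n) set" where "T n = Sigma {n0..n} E"

lemma finite_T: "finite (T n)"
  unfolding T_def using finite_E by (intro finite_SigmaI) auto

lemma support: "a \<in> carr A (n - j) \<Longrightarrow> e \<in> E j \<Longrightarrow> a \<noteq> 0 \<Longrightarrow> n0 \<le> j \<and> j \<le> n"
  using low_degree[of e j a "n - j"] neg_zero[of "n - j"] by force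

lemma coord_support:
  assumes "x \<in> carr F n" "x j e \<noteq> 0" shows "(j, e) \<in> T n"
proof -
  have "e \<in> E j" using assms by (auto simp: coord_mod_simps)
  then show ?thesis using support[OF coord_memD[OF assms(1)]] assms(2) by (auto simp: T_def)
qed

lemma finite_support: "x \<in> carr F n \<Longrightarrow> finite {(j, e). e \<in> E j \<and> x j e \<noteq> 0}"
  by (rule finite_subset[OF _ finite_T[of n]]) (auto dest: coord_support)

lemma F_bounded: "i < n0 \<Longrightarrow> carr F i = {0}"
  using coord_support[of _ i] by (fastforce simp: T_def)

abbreviation "P \<equiv> bchg t F"

lemma P_simps: "carr P i = carr F i \<times> carr F (i - 1)"
  "smul P r (x, y) = (smul F r x, smul F r y)"
  "act P i j (a, b) (x, y) = (act F i j a x, act F (i - 1) j b x + sgnact i (act F i (j - 1) a y))"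
  by (simp_all add: bchg_def)

text \<open>Identifies pairs of A-valued coordinate functions with one function valued in the Koszul
  extension, the entry at (j, e) being a0 + X a1.\<close>

definition coef :: "((int \<Rightarrow> 'n \<Rightarrow> 'a) \<times> (int \<Rightarrow> 'n \<Rightarrow> 'a)) \<Rightarrow> int \<Rightarrow> 'n \<Rightarrow> 'a \<times> 'a" where
  "coef u j e = (fst u j e, snd u j e)"

lemma coef_mem: "u \<in> carr P n \<Longrightarrow> coef u j e \<in> carr (kos A t) (n - j)"
  using coord_memD[of "fst u" E n j e] coord_memD[of "snd u" E "n - 1" j e]
  by (auto simp: P_simps carr_kos coef_def algebra_simps)

lemma coef_support: "u \<in> carr P n \<Longrightarrow> coef u j e \<noteq> 0 \<Longrightarrow> (j, e) \<in> T n"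
  using coord_support[of "fst u" n j e] coord_support[of "snd u" "n - 1" j e]
  by (auto simp: P_simps coef_def zero_prod_def T_def)

lemma coef_add: "coef (u + v) j e = coef u j e + coef v j e"
  and coef_smul: "coef (smul P r u) j e = smul (kos A t) r (coef u j e)"
  by (cases u; simp add: coef_def P_simps smul_kos coord_mod_simps)+

lemma coef_act: "coef (act P i k b u) j e = mul (kos A t) i (k - j) b (coef u j e)"
  by (cases b; cases u) (simp add: coef_def P_simps mul_kos coord_mod_simps sgnact_apply algebra_simps)

lemma coef_inject: "coef u = coef v \<longleftrightarrow> u = v"
  by (auto simp: coef_def fun_eq_iff prod_eq_iff)

text \<open>Summing over the fixed set \<open>T n\<close> instead of the support of u makes
  additivity immediate.\<close>

definition \<Phi> :: "int \<Rightarrow> (int \<Rightarrow> 'n \<Rightarrow> 'a) \<times> (int \<Rightarrow> 'n \<Rightarrow> 'a) \<Rightarrow> 'n" where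
  "\<Phi> n u = (\<Sum>(j, e)\<in>T n. act N (n - j) j (coef u j e) e)"

lemma T_E: "(j, e) \<in> T n \<Longrightarrow> e \<in> E j"
  by (simp add: T_def)

text \<open>Needed for linearity: a scalar of degree i changes the index set from \<open>T k\<close>
  to \<open>T (i + k)\<close>, and the added terms have zero coefficients.\<close>

lemma \<Phi>_superset:
  assumes "u \<in> carr P n" "n \<le> m"
  shows "\<Phi> n u = (\<Sum>(j, e)\<in>T m. act N (n - j) j (coef u j e) e)"
  unfolding \<Phi>_def
proof (rule sum.mono_neutral_left[OF finite_T])
  show "T n \<subseteq> T m" using assms(2) by (auto simp: T_def)
  show "\<forall>p\<in>T m - T n. (case p of (j, e) \<Rightarrow> act N (n - j) j (coef u j e) e) = 0"
  proof clarify
    fix j e assume "(j, e) \<in> T m" "(j, e) \<notin> T n"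
    then have "coef u j e = 0" "e \<in> carr N j"
      using coef_support[OF assms(1), of j e] E_mem[OF T_E] by auto
    then show "act N (n - j) j (coef u j e) e = 0" by simp
  qed
qed

lemma \<Phi>_term_mem: "u \<in> carr P n \<Longrightarrow> (j, e) \<in> T m \<Longrightarrow> act N (n - j) j (coef u j e) e \<in> carr N n"
  using coef_mem[of u n j e] by (auto dest!: T_E E_mem)

lemma \<Phi>_mem: "u \<in> carr P n \<Longrightarrow> \<Phi> n u \<in> carr N n"
  unfolding \<Phi>_def by (rule N.sum_mem) (auto intro: \<Phi>_term_mem)

lemma \<Phi>_add: "u \<in> carr P n \<Longrightarrow> v \<in> carr P n \<Longrightarrow> \<Phi> n (u + v) = \<Phi> n u + \<Phi> n v"
  unfolding \<Phi>_def sum.distrib[symmetric]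
  by (intro sum.cong refl) (auto simp: coef_add coef_mem N.act_add_left dest!: T_E E_mem)

lemma \<Phi>_smul: "u \<in> carr P n \<Longrightarrow> \<Phi> n (smul P r u) = smul N r (\<Phi> n u)"
  unfolding \<Phi>_def
  by (subst N.smul_sum[of _ _ n])
    (auto simp: coef_smul coef_mem N.act_smul_left \<Phi>_term_mem intro!: sum.cong dest!: T_E E_mem)

lemma \<Phi>_act:
  assumes b: "b \<in> carr (kos A t) i" and u: "u \<in> carr P k"
  shows "\<Phi> (i + k) (act P i k b u) = act N i k b (\<Phi> k u)"
proof -
  \<comment> \<open>One index set large enough for both degrees, whatever the sign of i.\<close>
  let ?m = "max k (i + k)"
  have "act P i k b u \<in> carr P (i + k)"
    using b u by (auto simp: P_simps carr_kos)
  then have "\<Phi> (i + k) (act P i k b u) = (\<Sum>(j, e)\<in>T ?m. act N (i + k - j) j (coef (act P i k b u) j e) e)"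
    by (rule \<Phi>_superset) simp
  also have "\<dots> = (\<Sum>(j, e)\<in>T ?m. act N i k b (act N (k - j) j (coef u j e) e))"
  proof (intro sum.cong refl, clarify)
    fix j e assume "(j, e) \<in> T ?m"
    then have "e \<in> carr N j" by (rule E_mem[OF T_E])
    from N.act_act[OF b coef_mem[OF u, of j e] this]
    show "act N (i + k - j) j (coef (act P i k b u) j e) e = act N i k b (act N (k - j) j (coef u j e) e)"
      by (simp add: coef_act add_diff_eq)
  qed
  also have "\<dots> = act N i k b (\<Sum>(j, e)\<in>T ?m. act N (k - j) j (coef u j e) e)"
    using b u by (subst N.act_sum_right) (auto simp: \<Phi>_term_mem case_prod_beta)
  also have "(\<Sum>(j, e)\<in>T ?m. act N (k - j) j (coef u j e) e) = \<Phi> k u"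
    by (rule \<Phi>_superset[OF u, symmetric]) simp
  finally show ?thesis .
qed

lemma is_coord_coef:
  assumes u: "u \<in> carr P n" shows "is_coord n (\<Phi> n u) (coef u)"
proof (intro conjI allI impI)
  show "finite {(j, e). e \<in> E j \<and> coef u j e \<noteq> 0}"
    by (rule finite_subset[OF _ finite_T[of n]]) (auto dest: coef_support[OF u])
  show "coef u j e \<in> carr (kos A t) (n - j)" for j e by (rule coef_mem[OF u])
  show "coef u j e = 0" if "e \<notin> E j" for j e
    using coef_support[OF u, of j e] that T_E by blast
  show "\<Phi> n u = (\<Sum>(j, e)\<in>{(j, e). e \<in> E j \<and> coef u j e \<noteq> 0}. act N (n - j) j (coef u j e) e)"
    unfolding \<Phi>_def
  proof (rule sum.mono_neutral_right[OF finite_T])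
    show "\<forall>p\<in>T n - {(j, e). e \<in> E j \<and> coef u j e \<noteq> 0}.
        (case p of (j, e) \<Rightarrow> act N (n - j) j (coef u j e) e) = 0"
      using N.act_zero_left[OF E_mem] by (auto dest!: T_E)
  qed (auto dest: coef_support[OF u])
qed

text \<open>Injectivity is uniqueness of coefficients in the semi-basis; surjectivity is their
  existence, each coefficient being split into its two A-parts.\<close>

lemma \<Phi>_bij: "bij_betw (\<Phi> n) (carr P n) (carr N n)"
  unfolding bij_betw_def
proof (intro conjI inj_onI equalityI subsetI)
  fix u v assume u: "u \<in> carr P n" and v: "v \<in> carr P n" and eq: "\<Phi> n u = \<Phi> n v"
  have "coef u = coef v"
    by (rule ex1_unique[OF ex1_coord[OF \<Phi>_mem[OF u]]])
      (rule is_coord_coef[OF u], unfold eq, rule is_coord_coef[OF v])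
  then show "u = v" by (simp add: coef_inject)
next
  fix x assume "x \<in> \<Phi> n ` carr P n" then show "x \<in> carr N n" using \<Phi>_mem by auto
next
  fix x assume x: "x \<in> carr N n"
  obtain c where c: "is_coord n x c" using ex1_implies_ex[OF ex1_coord[OF x]] by (elim exE)
  define u where "u = ((\<lambda>j e. fst (c j e)), (\<lambda>j e. snd (c j e)))"
  have "coef u = c" by (intro ext) (simp add: u_def coef_def)
  have "c j e \<in> carr A (n - j) \<times> carr A (n - j - 1)" if "e \<in> E j" for j e
    using c that by (simp add: carr_kos)
  moreover have "c j e = (0, 0)" if "e \<notin> E j" for j e
    using c that by (simp add: zero_prod_def)
  ultimately have u: "u \<in> carr P n"
    by (auto simp: P_simps u_def coord_mod_simps mem_Times_iff algebra_simps)
  have "x = \<Phi> n u"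
    using is_coord_coef[OF u] c unfolding \<open>coef u = c\<close> by argo
  then show "x \<in> \<Phi> n ` carr P n" using u by blast
qed

lemma difN: "x \<in> carr N i \<Longrightarrow> dif N i x \<in> carr N (i - 1)"
  "x \<in> carr N i \<Longrightarrow> y \<in> carr N i \<Longrightarrow> dif N i (x + y) = dif N i x + dif N i y"
  "x \<in> carr N i \<Longrightarrow> dif N i (smul N r x) = smul N r (dif N i x)"
  "x \<in> carr N i \<Longrightarrow> dif N (i - 1) (dif N i x) = 0"
  "b \<in> carr (kos A t) i \<Longrightarrow> x \<in> carr N j \<Longrightarrow> dif N (i + j) (act N i j b x)
    = act N (i - 1) j (dif (kos A t) i b) x + sgnact i (act N i (j - 1) b (dif N j x))"
  using dgm unfolding is_dgm_def is_cx_def rlin_def by simp_all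

text \<open>The differential of N is pulled back along \<Phi>. Each axiom for the result is checked
  after applying the injective map \<Phi>, where it becomes an axiom of N;
  \<open>koszul_module_of_dif\<close> then extracts \<alpha> and \<beta>.\<close>

lemma twisted_form:
  obtains \<alpha> \<beta> where "koszul_module F A t \<alpha> \<beta>" "dg_iso (kos A t) N (twist t F \<alpha> \<beta>)"
proof -
  define D where "D = (\<lambda>i u. inv_into (carr P (i - 1)) (\<Phi> (i - 1)) (dif N i (\<Phi> i u)))"
  have P_rmod: "rmod (smul P) (carr P i)" for i
    by (auto simp: rmod_def P_simps zero_prod_def F.smul_add F.add_smul F.smul_smul F.smul_one)
  interpret P: graded_rmod P by unfold_locales (rule P_rmod)
  have actP: "act P i j b u \<in> carr P (i + j)" if "b \<in> carr (kos A t) i" "u \<in> carr P j" for i j b u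
    using that by (auto simp: P_simps carr_kos)
  have \<Phi>_inj: "u = v" if "\<Phi> i u = \<Phi> i v" "u \<in> carr P i" "v \<in> carr P i" for i u v
    using \<Phi>_bij[of i] that by (auto simp: bij_betw_def inj_on_def)
  have D_mem: "D i u \<in> carr P (i - 1)" and \<Phi>D: "\<Phi> (i - 1) (D i u) = dif N i (\<Phi> i u)"
    if "u \<in> carr P i" for i u
    using difN(1)[OF \<Phi>_mem[OF that]] \<Phi>_bij[of "i - 1"]
    by (auto simp: D_def bij_betw_def intro: inv_into_into f_inv_into_f)
  have \<Phi>_sgn: "\<Phi> i (sgnact k u) = sgnact k (\<Phi> i u)" if "u \<in> carr P i" for i k u
    by (rule rlin_sgnact[OF _ P_rmod that, of "smul N" "carr N i"])
      (auto simp: rlin_def \<Phi>_mem \<Phi>_add \<Phi>_smul)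
  have \<Phi>0: "\<Phi> i 0 = 0" for i
    using \<Phi>_add[of 0 i 0] P.zero_mem[of i] by simp
  obtain \<alpha> \<beta> where K: "koszul_module F A t \<alpha> \<beta>"
    and D: "\<And>i u. u \<in> carr P i \<Longrightarrow> D i u = dif (twist t F \<alpha> \<beta>) i u"
  proof (rule koszul_module_of_dif[OF F.graded_act_axioms, of t D])
    show "D i u \<in> carr P (i - 1)" if "u \<in> carr P i" for i u using D_mem that .
    show "D i (u + v) = D i u + D i v" if "u \<in> carr P i" "v \<in> carr P i" for i u v
      using that by (intro \<Phi>_inj[of "i - 1"]) (simp_all add: \<Phi>D D_mem \<Phi>_add difN \<Phi>_mem)
    show "D i (smul P r u) = smul P r (D i u)" if "u \<in> carr P i" for i r u
      using that by (intro \<Phi>_inj[of "i - 1"]) (simp_all add: \<Phi>D D_mem \<Phi>_smul difN \<Phi>_mem)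
    show "D (i - 1) (D i u) = 0" if "u \<in> carr P i" for i u
    proof (rule \<Phi>_inj[of "i - 1 - 1"])
      show "\<Phi> (i - 1 - 1) (D (i - 1) (D i u)) = \<Phi> (i - 1 - 1) 0"
        using that by (simp only: \<Phi>D D_mem difN(4) \<Phi>_mem \<Phi>0)
    qed (use D_mem[OF D_mem[OF that]] in auto)
    show "D (i + j) (act P i j b u) = act P (i - 1) j (dif (kos A t) i b) u + sgnact i (act P i (j - 1) b (D j u))"
      if b: "b \<in> carr (kos A t) i" and u: "u \<in> carr P j" for i j b u
    proof -
      have db: "dif (kos A t) i b \<in> carr (kos A t) (i - 1)"
        using b rlin_mem[OF dgaD(11)[OF dga], of _ i] rlin_mem[OF dgaD(11)[OF dga], of _ "i - 1"]
        by (auto simp: carr_kos dif_kos)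
      have m: "act P (i - 1) j (dif (kos A t) i b) u \<in> carr P (i + j - 1)"
        "act P i (j - 1) b (D j u) \<in> carr P (i + j - 1)"
        using actP[OF db u] actP[OF b D_mem[OF u]] by (simp_all add: algebra_simps)
      show ?thesis
      proof (rule \<Phi>_inj[of "i + j - 1"])
        have "\<Phi> (i + j - 1) (act P (i - 1) j (dif (kos A t) i b) u + sgnact i (act P i (j - 1) b (D j u)))
            = act N (i - 1) j (dif (kos A t) i b) (\<Phi> j u) + sgnact i (act N i (j - 1) b (\<Phi> (j - 1) (D j u)))"
          using \<Phi>_act[OF db u] \<Phi>_act[OF b D_mem[OF u]] m
          by (simp add: \<Phi>_add \<Phi>_sgn algebra_simps)
        then show "\<Phi> (i + j - 1) (D (i + j) (act P i j b u))
            = \<Phi> (i + j - 1) (act P (i - 1) j (dif (kos A t) i b) u + sgnact i (act P i (j - 1) b (D j u)))"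
          using b u actP[OF b u] by (simp add: \<Phi>D \<Phi>_act difN \<Phi>_mem)
      qed (use m D_mem[OF actP[OF b u]] in auto)
    qed
  qed (rule that)
  interpret K: koszul_module F A t \<alpha> \<beta> by (rule K)
  have eq: "carr (twist t F \<alpha> \<beta>) = carr P" "smul (twist t F \<alpha> \<beta>) = smul P" "act (twist t F \<alpha> \<beta>) = act P"
    by (simp_all add: twist_def)
  have "dg_hom (kos A t) (twist t F \<alpha> \<beta>) N \<Phi>"
    unfolding dg_hom_def eq using \<Phi>D D
    by (auto simp: rlin_def \<Phi>_mem \<Phi>_add \<Phi>_smul \<Phi>_act)
  then have "dg_iso (kos A t) (twist t F \<alpha> \<beta>) N"
    by (rule dg_isoI) (simp add: eq \<Phi>_bij)
  then have "dg_iso (kos A t) N (twist t F \<alpha> \<beta>)"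
    by (rule dg_iso_sym[OF _ K.rmod_twist K.dif_twist_mem K.act_twist_mem])
  with K show thesis by (rule that)
qed

end

section \<open>Lifting of N along the Koszul extension\<close>

theorem theorem3p4:
  fixes A :: "('r::comm_ring_1, 'a::ab_group_add) dga"
    and t :: 'r
    and N :: "('r, 'a \<times> 'a, 'n::ab_group_add) dgm"
  assumes "noetherian TYPE('r)"
    and "is_dga A"
    and "\<forall>i. free_fin_rank (smul A) (carr A i)"
    and "adic_complete t"
    and "is_dgm (kos A t) N"
    and "semifree (kos A t) N"
    and "\<exists>E. semibasis (kos A t) N E \<and> (\<forall>j. finite (E j))"
    and "ext_zero (kos A t) N N 2"
  shows "\<exists>M :: ('r, 'a, int \<Rightarrow> 'n \<Rightarrow> 'a) dgm.
           is_dgm A M \<and> semifree A M \<and> dg_iso (kos A t) N (bchg t M)"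
proof -
  obtain E where E: "semibasis (kos A t) N E" "\<forall>j. finite (E j)" using assms(7) by (elim exE conjE)
  obtain n0 where n0: "\<forall>i<n0. carr N i = {0}" using assms(6) unfolding semifree_def by (elim exE conjE)
  interpret A: dga_mod A by unfold_locales (rule assms(2))
  interpret N: graded_act N "kos A t" by (rule graded_act_dgm[OF rmod_kos[OF assms(2)] assms(5)])
  interpret S: semifree_finite A t N E n0
    using E n0 assms(5) by unfold_locales auto
  obtain \<alpha> \<beta> where K: "koszul_module S.F A t \<alpha> \<beta>" and iso: "dg_iso (kos A t) N (twist t S.F \<alpha> \<beta>)"
    by (rule S.twisted_form)
  interpret K: koszul_module S.F A t \<alpha> \<beta> by (rule K)
  have ext: "ext_zero (kos A t) (twist t S.F \<alpha> \<beta>) (twist t S.F \<alpha> \<beta>) 2"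
    by (rule ext_zero_dg_iso[OF iso assms(8) N.rmod_carr S.difN(1) N.act_mem'
      K.rmod_twist K.dif_twist_mem K.act_twist_mem])
  \<comment> \<open>Components of A are complete, being free of finite rank over R, and components
    of F are products of these.\<close>
  have complete: "tadic_complete t (smul S.F) (carr S.F i)" for i
    using assms(3,4) by (intro A.tadic_complete_coord A.tadic_complete_free) auto
  obtain \<alpha>0 where dgm: "is_dgm A (S.F\<lparr>dif := \<alpha>0\<rparr>)"
    and iso': "dg_iso (kos A t) (twist t S.F \<alpha> \<beta>) (bchg t (S.F\<lparr>dif := \<alpha>0\<rparr>))"
    by (rule K.dg_iso_lift[OF ext complete])
  \<comment> \<open>A semi-basis involves only carriers and action, so it survives the replacement
    of the placeholder differential.\<close>
  have "\<exists>E'. semibasis A S.F E'" by (rule A.semibasis_coord[OF S.finite_support])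
  then have "semifree A (S.F\<lparr>dif := \<alpha>0\<rparr>)"
    using S.F_bounded unfolding semifree_def semibasis_def by auto
  with dgm dg_iso_trans[OF iso iso'] show ?thesis by blast
qed

end
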